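(* Let $k$ be a field, let $M=ka\oplus kb$ and $N=kx$ be abelian Lie algebras over $k$ with bases $a,b$ and $x$ respectively, and let $L=M*N=\langle a,b,x\mid [a,b]\rangle$. Let $S$ be the Lie subalgebra of $L$ generated by $a$, $b$, $z=[x,a]$ and $t=[x,b]$. Then $S$ is not a right angled Artin Lie algebra, i.e. $S$ is not isomorphic to $L_\Gamma$ for any finite simple graph $\Gamma$.
   Context: $*$ denotes the free product (coproduct) of Lie algebras over $k$, and $\langle X\mid R\rangle$ denotes the free Lie algebra on $X$ modulo the ideal generated by $R$. For a finite simple graph $\Gamma$ the right angled Artin Lie algebra is $L_\Gamma=\langle V(\Gamma)\mid [u,v]=0\text{ whenever }\{u,v\}\in E(\Gamma)\rangle$. *)

theory Defs
  imports
    "HOL-Algebra.QuotRing"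
    "Jordan_Normal_Form.Missing_VectorSpace"
    "Graph_Theory.Digraph"
begin

text \<open>
  An algebra over a field \<^term>\<open>K\<close> is a \<^typ>\<open>('k, 'a) module\<close> record whose field
  \<^const>\<open>mult\<close> is the product; for a Lie algebra it is the bracket, so
  \<open>x \<otimes>\<^bsub>L\<^esub> y\<close> is $[x,y]$.  The field \<^const>\<open>one\<close> of the record has no meaning here.
\<close>

locale lie_algebra = vectorspace K L for K and L (structure) +
  assumes bracket_closed:
      "\<lbrakk>x \<in> carrier L; y \<in> carrier L\<rbrakk> \<Longrightarrow> x \<otimes>\<^bsub>L\<^esub> y \<in> carrier L"
    and bracket_add_left:
      "\<lbrakk>x \<in> carrier L; y \<in> carrier L; z \<in> carrier L\<rbrakk> \<Longrightarrow>
        (x \<oplus>\<^bsub>L\<^esub> y) \<otimes>\<^bsub>L\<^esub> z = x \<otimes>\<^bsub>L\<^esub> z \<oplus>\<^bsub>L\<^esub> y \<otimes>\<^bsub>L\<^esub> z"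
    and bracket_add_right:
      "\<lbrakk>x \<in> carrier L; y \<in> carrier L; z \<in> carrier L\<rbrakk> \<Longrightarrow>
        x \<otimes>\<^bsub>L\<^esub> (y \<oplus>\<^bsub>L\<^esub> z) = x \<otimes>\<^bsub>L\<^esub> y \<oplus>\<^bsub>L\<^esub> x \<otimes>\<^bsub>L\<^esub> z"
    and bracket_smult_left:
      "\<lbrakk>c \<in> carrier K; x \<in> carrier L; y \<in> carrier L\<rbrakk> \<Longrightarrow>
        (c \<odot>\<^bsub>L\<^esub> x) \<otimes>\<^bsub>L\<^esub> y = c \<odot>\<^bsub>L\<^esub> (x \<otimes>\<^bsub>L\<^esub> y)"
    and bracket_smult_right:
      "\<lbrakk>c \<in> carrier K; x \<in> carrier L; y \<in> carrier L\<rbrakk> \<Longrightarrow>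
        x \<otimes>\<^bsub>L\<^esub> (c \<odot>\<^bsub>L\<^esub> y) = c \<odot>\<^bsub>L\<^esub> (x \<otimes>\<^bsub>L\<^esub> y)"
    and bracket_self:
      "x \<in> carrier L \<Longrightarrow> x \<otimes>\<^bsub>L\<^esub> x = \<zero>\<^bsub>L\<^esub>"
    and jacobi:
      "\<lbrakk>x \<in> carrier L; y \<in> carrier L; z \<in> carrier L\<rbrakk> \<Longrightarrow>
        x \<otimes>\<^bsub>L\<^esub> (y \<otimes>\<^bsub>L\<^esub> z) \<oplus>\<^bsub>L\<^esub> y \<otimes>\<^bsub>L\<^esub> (z \<otimes>\<^bsub>L\<^esub> x) \<oplus>\<^bsub>L\<^esub> z \<otimes>\<^bsub>L\<^esub> (x \<otimes>\<^bsub>L\<^esub> y) = \<zero>\<^bsub>L\<^esub>"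

definition abelian_lie_algebra ::
    "('k, 'r) ring_scheme \<Rightarrow> ('k, 'a, 'm) module_scheme \<Rightarrow> bool" where
  "abelian_lie_algebra K L \<longleftrightarrow>
     lie_algebra K L \<and> (\<forall>x \<in> carrier L. \<forall>y \<in> carrier L. x \<otimes>\<^bsub>L\<^esub> y = \<zero>\<^bsub>L\<^esub>)"

definition alg_iso ::
    "('k, 'r) ring_scheme \<Rightarrow> ('k, 'a, 'm) module_scheme \<Rightarrow> ('k, 'b, 'n) module_scheme \<Rightarrow>
      ('a \<Rightarrow> 'b) set" where
  "alg_iso K A B = {f \<in> LinearCombinations.module_hom K A B.
     (\<forall>x \<in> carrier A. \<forall>y \<in> carrier A. f (x \<otimes>\<^bsub>A\<^esub> y) = f x \<otimes>\<^bsub>B\<^esub> f y) \<and>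
     bij_betw f (carrier A) (carrier B)}"

definition alg_isomorphic ::
    "('k, 'r) ring_scheme \<Rightarrow> ('k, 'a, 'm) module_scheme \<Rightarrow> ('k, 'b, 'n) module_scheme \<Rightarrow>
      bool" where
  "alg_isomorphic K A B \<longleftrightarrow> alg_iso K A B \<noteq> {}"


section \<open>Subalgebras, ideals and quotients\<close>

definition subalg ::
    "('k, 'r) ring_scheme \<Rightarrow> 'a set \<Rightarrow> ('k, 'a, 'm) module_scheme \<Rightarrow> bool" where
  "subalg K S A \<longleftrightarrow> VectorSpace.subspace K S A \<and> (\<forall>x \<in> S. \<forall>y \<in> S. x \<otimes>\<^bsub>A\<^esub> y \<in> S)"

definition subalg_gen ::
    "('k, 'r) ring_scheme \<Rightarrow> ('k, 'a, 'm) module_scheme \<Rightarrow> 'a set \<Rightarrow> 'a set" where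
  "subalg_gen K A G = \<Inter>{S. subalg K S A \<and> G \<subseteq> S}"

definition alg_ideal ::
    "('k, 'r) ring_scheme \<Rightarrow> 'a set \<Rightarrow> ('k, 'a, 'm) module_scheme \<Rightarrow> bool" where
  "alg_ideal K I A \<longleftrightarrow> VectorSpace.subspace K I A \<and>
     (\<forall>x \<in> carrier A. \<forall>y \<in> I. x \<otimes>\<^bsub>A\<^esub> y \<in> I \<and> y \<otimes>\<^bsub>A\<^esub> x \<in> I)"

definition alg_ideal_gen ::
    "('k, 'r) ring_scheme \<Rightarrow> ('k, 'a, 'm) module_scheme \<Rightarrow> 'a set \<Rightarrow> 'a set" where
  "alg_ideal_gen K A R = \<Inter>{I. alg_ideal K I A \<and> R \<subseteq> I}"

text \<open>
  \<^const>\<open>FactRing\<close> together with the induced scalar multiplication; when \<open>I\<close> is an ideal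
  the sets united below are all equal, as in \<^const>\<open>rcoset_mult\<close>.
\<close>

definition alg_quot ::
    "('k, 'a, 'm) module_scheme \<Rightarrow> 'a set \<Rightarrow> ('k, 'a set) module" where
  "alg_quot A I =
    \<lparr>carrier = a_rcosets\<^bsub>A\<^esub> I, mult = rcoset_mult A I, one = I +>\<^bsub>A\<^esub> \<one>\<^bsub>A\<^esub>,
     zero = I, add = set_add A, smult = (\<lambda>c C. \<Union>x\<in>C. I +>\<^bsub>A\<^esub> (c \<odot>\<^bsub>A\<^esub> x))\<rparr>"


section \<open>Free Lie algebras and presentations\<close>

text \<open>
  The free nonassociative algebra on \<open>X\<close> is the algebra of the free magma on \<open>X\<close>:
  finitely supported functions on nonassociative words with letters in \<open>X\<close>.  Every word
  that is not a letter factors uniquely, so the convolution product has one summand.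
\<close>

datatype 'x magma = Letter 'x | Prod "'x magma" "'x magma"

definition free_nonassoc ::
    "('k, 'r) ring_scheme \<Rightarrow> 'x set \<Rightarrow> ('k, 'x magma \<Rightarrow> 'k) module" where
  "free_nonassoc K X =
    \<lparr>carrier = {f. (\<forall>w. f w \<in> carrier K) \<and> finite {w. f w \<noteq> \<zero>\<^bsub>K\<^esub>} \<and>
                   (\<forall>w. f w \<noteq> \<zero>\<^bsub>K\<^esub> \<longrightarrow> set_magma w \<subseteq> X)},
     mult = (\<lambda>f g w. case w of Letter x \<Rightarrow> \<zero>\<^bsub>K\<^esub> | Prod u v \<Rightarrow> f u \<otimes>\<^bsub>K\<^esub> g v),
     one = (\<lambda>w. \<zero>\<^bsub>K\<^esub>),
     zero = (\<lambda>w. \<zero>\<^bsub>K\<^esub>),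
     add = (\<lambda>f g w. f w \<oplus>\<^bsub>K\<^esub> g w),
     smult = (\<lambda>c f w. c \<otimes>\<^bsub>K\<^esub> f w)\<rparr>"

definition lie_axioms_ideal ::
    "('k, 'r) ring_scheme \<Rightarrow> 'x set \<Rightarrow> ('x magma \<Rightarrow> 'k) set" where
  "lie_axioms_ideal K X = (let A = free_nonassoc K X in
     alg_ideal_gen K A
       ({f \<otimes>\<^bsub>A\<^esub> f | f. f \<in> carrier A} \<union>
        {f \<otimes>\<^bsub>A\<^esub> (g \<otimes>\<^bsub>A\<^esub> h) \<oplus>\<^bsub>A\<^esub> g \<otimes>\<^bsub>A\<^esub> (h \<otimes>\<^bsub>A\<^esub> f) \<oplus>\<^bsub>A\<^esub> h \<otimes>\<^bsub>A\<^esub> (f \<otimes>\<^bsub>A\<^esub> g) | f g h.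
           f \<in> carrier A \<and> g \<in> carrier A \<and> h \<in> carrier A}))"

definition free_lie ::
    "('k, 'r) ring_scheme \<Rightarrow> 'x set \<Rightarrow> ('k, ('x magma \<Rightarrow> 'k) set) module" where
  "free_lie K X = alg_quot (free_nonassoc K X) (lie_axioms_ideal K X)"

definition free_lie_gen ::
    "('k, 'r) ring_scheme \<Rightarrow> 'x set \<Rightarrow> 'x \<Rightarrow> ('x magma \<Rightarrow> 'k) set" where
  "free_lie_gen K X x = lie_axioms_ideal K X
     +>\<^bsub>free_nonassoc K X\<^esub> (\<lambda>w. if w = Letter x then \<one>\<^bsub>K\<^esub> else \<zero>\<^bsub>K\<^esub>)"

definition lie_pres ::
    "('k, 'r) ring_scheme \<Rightarrow> 'x set \<Rightarrow> ('x magma \<Rightarrow> 'k) set set \<Rightarrow>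
      ('k, ('x magma \<Rightarrow> 'k) set set) module" where
  "lie_pres K X R = alg_quot (free_lie K X) (alg_ideal_gen K (free_lie K X) R)"

definition lie_pres_gen ::
    "('k, 'r) ring_scheme \<Rightarrow> 'x set \<Rightarrow> ('x magma \<Rightarrow> 'k) set set \<Rightarrow> 'x \<Rightarrow>
      ('x magma \<Rightarrow> 'k) set set" where
  "lie_pres_gen K X R x =
     alg_ideal_gen K (free_lie K X) R +>\<^bsub>free_lie K X\<^esub> free_lie_gen K X x"


section \<open>Free products\<close>

text \<open>
  The elements of \<open>F\<close> that have to vanish for \<open>i\<close> to become a homomorphism of algebras
  from \<open>M\<close> to a quotient of \<open>F\<close>.
\<close>

definition hom_relators ::
    "('k, 'r) ring_scheme \<Rightarrow> ('k, 'a, 'm) module_scheme \<Rightarrow> ('k, 'b, 'n) module_scheme \<Rightarrow>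
      ('a \<Rightarrow> 'b) \<Rightarrow> 'b set" where
  "hom_relators K M F i =
     {i (u \<oplus>\<^bsub>M\<^esub> v) \<ominus>\<^bsub>F\<^esub> (i u \<oplus>\<^bsub>F\<^esub> i v) | u v. u \<in> carrier M \<and> v \<in> carrier M} \<union>
     {i (c \<odot>\<^bsub>M\<^esub> u) \<ominus>\<^bsub>F\<^esub> (c \<odot>\<^bsub>F\<^esub> i u) | c u. c \<in> carrier K \<and> u \<in> carrier M} \<union>
     {i (u \<otimes>\<^bsub>M\<^esub> v) \<ominus>\<^bsub>F\<^esub> (i u \<otimes>\<^bsub>F\<^esub> i v) | u v. u \<in> carrier M \<and> v \<in> carrier M}"

text \<open>
  The coproduct of \<open>M\<close> and \<open>N\<close>, presented by all elements of \<open>M\<close> and \<open>N\<close> (made disjoint by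
  \<^const>\<open>Inl\<close> and \<^const>\<open>Inr\<close>) and all relations that hold in \<open>M\<close> or in \<open>N\<close>.
\<close>

definition free_prod_letters ::
    "('k, 'a, 'm) module_scheme \<Rightarrow> ('k, 'b, 'n) module_scheme \<Rightarrow> ('a + 'b) set" where
  "free_prod_letters M N = Inl ` carrier M \<union> Inr ` carrier N"

definition free_prod_relators ::
    "('k, 'r) ring_scheme \<Rightarrow> ('k, 'a, 'm) module_scheme \<Rightarrow> ('k, 'b, 'n) module_scheme \<Rightarrow>
      (('a + 'b) magma \<Rightarrow> 'k) set set" where
  "free_prod_relators K M N =
    (let X = free_prod_letters M N; F = free_lie K X; g = free_lie_gen K X
     in hom_relators K M F (\<lambda>u. g (Inl u)) \<union> hom_relators K N F (\<lambda>v. g (Inr v)))"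

definition lie_free_prod ::
    "('k, 'r) ring_scheme \<Rightarrow> ('k, 'a, 'm) module_scheme \<Rightarrow> ('k, 'b, 'n) module_scheme \<Rightarrow>
      ('k, (('a + 'b) magma \<Rightarrow> 'k) set set) module" where
  "lie_free_prod K M N = lie_pres K (free_prod_letters M N) (free_prod_relators K M N)"

definition free_prod_inl ::
    "('k, 'r) ring_scheme \<Rightarrow> ('k, 'a, 'm) module_scheme \<Rightarrow> ('k, 'b, 'n) module_scheme \<Rightarrow>
      'a \<Rightarrow> (('a + 'b) magma \<Rightarrow> 'k) set set" where
  "free_prod_inl K M N u =
     lie_pres_gen K (free_prod_letters M N) (free_prod_relators K M N) (Inl u)"

definition free_prod_inr ::
    "('k, 'r) ring_scheme \<Rightarrow> ('k, 'a, 'm) module_scheme \<Rightarrow> ('k, 'b, 'n) module_scheme \<Rightarrow>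
      'b \<Rightarrow> (('a + 'b) magma \<Rightarrow> 'k) set set" where
  "free_prod_inr K M N v =
     lie_pres_gen K (free_prod_letters M N) (free_prod_relators K M N) (Inr v)"


section \<open>Right angled Artin Lie algebras\<close>

text \<open>
  The locale \<^locale>\<open>graph\<close> describes finite simple graphs as finite symmetric digraphs without
  loops and multiple arcs.  Each edge $\{u,v\}$ gives both relators $[u,v]$ and $[v,u]$.
\<close>

definition raa_lie ::
    "('k, 'r) ring_scheme \<Rightarrow> ('v, 'e) pre_digraph \<Rightarrow>
      ('k, ('v magma \<Rightarrow> 'k) set set) module" where
  "raa_lie K \<Gamma> = lie_pres K (verts \<Gamma>)
     {free_lie_gen K (verts \<Gamma>) u \<otimes>\<^bsub>free_lie K (verts \<Gamma>)\<^esub> free_lie_gen K (verts \<Gamma>) v | u v.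
        u \<rightarrow>\<^bsub>\<Gamma>\<^esub> v}"

end

theory Submission
  imports Defs
begin

text \<open>
  The relations of \<open>S\<close> in degree 2 are \<open>[a,b] = 0\<close> and, by the Jacobi identity,
  \<open>[z,b] + [a,t] = 0\<close>.  Elements of \<open>S\<close> modulo \<open>[S,S]\<close> have coordinates with respect to \<open>a, b, z, t\<close>, and
  the Pluecker relation shows that if \<open>[u,v] = 0\<close> in \<open>S\<close> then \<open>u \<and> v\<close> is a multiple of \<open>a \<and> b\<close>
  modulo \<open>[S,S]\<close>; in particular its \<open>z \<and> b\<close> minor vanishes.  In a right angled Artin Lie algebra all
  quadratic relations are combinations of relations \<open>[u,v] = 0\<close> between commuting vertices.  Hence
  an isomorphism would make the \<open>z \<and> b\<close> minor vanish on every quadratic relation of \<open>S\<close>, but it is 1 on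
  \<open>[z,b] + [a,t] = 0\<close>.
\<close>

section \<open>Algebras, ideals and quotients\<close>

text \<open>No presentation or basis of \<open>S\<close> is at hand, so a map on \<open>S\<close>
  cannot be prescribed on \<open>a\<close>, \<open>b\<close>, \<open>z\<close>, \<open>t\<close>; it
  has to be the restriction of a homomorphism on the whole free product. That is why the target
  \<open>test_algebra\<close> carries an action of \<open>x\<close>, although \<open>x\<close> is
  not in \<open>S\<close>. This map gives lower bounds only: three of its coordinates show that
  certain brackets are nonzero. The upper bound needed is the one relation
  \<open>[z,b] + [a,t] = 0\<close>, which is the derivation \<open>[x,-]\<close> applied to
  \<open>[a,b] = 0\<close>.

  The obstruction is that \<open>z \<and> b + a \<and> t\<close> has rank 4, and that no nonzero
  multiple of it becomes decomposable by adding a multiple of \<open>a \<and> b\<close>. Squaring in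
  the exterior algebra would bring in a factor 2; the Pluecker quadric has no such factor and serves
  in every characteristic.

  On the graph side, a condition on commuting pairs has to become a linear statement about all
  quadratic relations. A Heisenberg bracket achieves this: the minor of two functionals is the
  central coordinate of a bracket, and a homomorphism realising it exists as soon as the minor
  vanishes on edges. The same test algebra contains such a bracket in the coordinates
  \<open>CX\<close>, \<open>CA0\<close>, \<open>CA1\<close>.\<close>

lemma (in abelian_group) minus_add_minus:
  assumes "x \<in> carrier G" and "y \<in> carrier G" and "z \<in> carrier G"
  shows "(x \<ominus> y) \<oplus> (y \<ominus> z) = x \<ominus> z"
proof -
  have "\<ominus> y \<oplus> (y \<oplus> \<ominus> z) = \<ominus> z"
    using assms by (intro r_neg1) auto
  then show ?thesis
    using assms by (simp only: a_minus_def a_assoc a_inv_closed a_closed)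
qed

lemma (in abelian_group) minus_eq_zero_imp_eq:
  assumes "x \<ominus> y = \<zero>" and "x \<in> carrier G" and "y \<in> carrier G"
  shows "x = y"
  using assms minus_equality[of x "\<ominus> y"] by (simp add: a_minus_def)

lemma (in abelian_group) minus_zero_right: "x \<in> carrier G \<Longrightarrow> x \<ominus> \<zero> = x"
  using minus_equality[of \<zero> \<zero>] by (simp add: a_minus_def)

text \<open>A bilinear product with no identities imposed: ideals, quotients and homomorphisms are
  then treated once, for the free nonassociative algebra and for Lie algebras alike.\<close>

locale nonassoc_algebra = vectorspace K A for K and A (structure) +
  assumes prod_closed [simp, intro]:
      "\<lbrakk>x \<in> carrier A; y \<in> carrier A\<rbrakk> \<Longrightarrow> x \<otimes>\<^bsub>A\<^esub> y \<in> carrier A"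
    and prod_add_left:
      "\<lbrakk>x \<in> carrier A; y \<in> carrier A; z \<in> carrier A\<rbrakk> \<Longrightarrow>
        (x \<oplus>\<^bsub>A\<^esub> y) \<otimes>\<^bsub>A\<^esub> z = x \<otimes>\<^bsub>A\<^esub> z \<oplus>\<^bsub>A\<^esub> y \<otimes>\<^bsub>A\<^esub> z"
    and prod_add_right:
      "\<lbrakk>x \<in> carrier A; y \<in> carrier A; z \<in> carrier A\<rbrakk> \<Longrightarrow>
        x \<otimes>\<^bsub>A\<^esub> (y \<oplus>\<^bsub>A\<^esub> z) = x \<otimes>\<^bsub>A\<^esub> y \<oplus>\<^bsub>A\<^esub> x \<otimes>\<^bsub>A\<^esub> z"
    and prod_smult_left:
      "\<lbrakk>c \<in> carrier K; x \<in> carrier A; y \<in> carrier A\<rbrakk> \<Longrightarrow>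
        (c \<odot>\<^bsub>A\<^esub> x) \<otimes>\<^bsub>A\<^esub> y = c \<odot>\<^bsub>A\<^esub> (x \<otimes>\<^bsub>A\<^esub> y)"
    and prod_smult_right:
      "\<lbrakk>c \<in> carrier K; x \<in> carrier A; y \<in> carrier A\<rbrakk> \<Longrightarrow>
        x \<otimes>\<^bsub>A\<^esub> (c \<odot>\<^bsub>A\<^esub> y) = c \<odot>\<^bsub>A\<^esub> (x \<otimes>\<^bsub>A\<^esub> y)"

sublocale lie_algebra \<subseteq> nonassoc_algebra K L
  by unfold_locales
    (auto simp: bracket_closed bracket_add_left bracket_add_right bracket_smult_left bracket_smult_right)

definition alg_hom ::
    "('k, 'r) ring_scheme \<Rightarrow> ('k, 'a, 'm) module_scheme \<Rightarrow> ('k, 'b, 'n) module_scheme \<Rightarrow>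
      ('a \<Rightarrow> 'b) set" where
  "alg_hom K A B = {f \<in> LinearCombinations.module_hom K A B.
     \<forall>x \<in> carrier A. \<forall>y \<in> carrier A. f (x \<otimes>\<^bsub>A\<^esub> y) = f x \<otimes>\<^bsub>B\<^esub> f y}"

lemma alg_iso_iff: "f \<in> alg_iso K A B \<longleftrightarrow> f \<in> alg_hom K A B \<and> bij_betw f (carrier A) (carrier B)"
  by (auto simp: alg_iso_def alg_hom_def)

lemma alg_homI:
  assumes "\<And>x. x \<in> carrier A \<Longrightarrow> f x \<in> carrier B"
    and "\<And>x y. \<lbrakk>x \<in> carrier A; y \<in> carrier A\<rbrakk> \<Longrightarrow> f (x \<oplus>\<^bsub>A\<^esub> y) = f x \<oplus>\<^bsub>B\<^esub> f y"
    and "\<And>c x. \<lbrakk>c \<in> carrier K; x \<in> carrier A\<rbrakk> \<Longrightarrow> f (c \<odot>\<^bsub>A\<^esub> x) = c \<odot>\<^bsub>B\<^esub> f x"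
    and "\<And>x y. \<lbrakk>x \<in> carrier A; y \<in> carrier A\<rbrakk> \<Longrightarrow> f (x \<otimes>\<^bsub>A\<^esub> y) = f x \<otimes>\<^bsub>B\<^esub> f y"
  shows "f \<in> alg_hom K A B"
  using assms by (auto simp: alg_hom_def LinearCombinations.module_hom_def)

lemma
  assumes "f \<in> alg_hom K A B"
  shows alg_hom_closed: "x \<in> carrier A \<Longrightarrow> f x \<in> carrier B"
    and alg_hom_add: "\<lbrakk>x \<in> carrier A; y \<in> carrier A\<rbrakk> \<Longrightarrow> f (x \<oplus>\<^bsub>A\<^esub> y) = f x \<oplus>\<^bsub>B\<^esub> f y"
    and alg_hom_smult: "\<lbrakk>c \<in> carrier K; x \<in> carrier A\<rbrakk> \<Longrightarrow> f (c \<odot>\<^bsub>A\<^esub> x) = c \<odot>\<^bsub>B\<^esub> f x"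
    and alg_hom_prod: "\<lbrakk>x \<in> carrier A; y \<in> carrier A\<rbrakk> \<Longrightarrow> f (x \<otimes>\<^bsub>A\<^esub> y) = f x \<otimes>\<^bsub>B\<^esub> f y"
  using assms by (auto simp: alg_hom_def LinearCombinations.module_hom_def)

lemmas alg_hom_simps = alg_hom_closed alg_hom_add alg_hom_smult alg_hom_prod

lemma alg_hom_comp:
  assumes "f \<in> alg_hom K A B" and "g \<in> alg_hom K B C"
  shows "g \<circ> f \<in> alg_hom K A C"
  using assms by (intro alg_homI) (simp_all add: alg_hom_simps[of f K A B] alg_hom_simps[of g K B C])

lemma alg_hom_linear_map:
  assumes "vectorspace K A" and "vectorspace K B" and "f \<in> alg_hom K A B"
  shows "linear_map K A B f"
  using assms unfolding linear_map_def mod_hom_def mod_hom_axioms_def alg_hom_def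
  by (auto simp: vectorspace.axioms)

context
  fixes K :: "('k, 'r) ring_scheme" and A :: "('k, 'a, 'm) module_scheme" and B :: "('k, 'b, 'n) module_scheme" and f
  assumes vs: "vectorspace K A" "vectorspace K B" and f: "f \<in> alg_hom K A B"
begin

interpretation linear_map K A B f
  using alg_hom_linear_map[OF vs f] .

lemma alg_hom_zero: "f \<zero>\<^bsub>A\<^esub> = \<zero>\<^bsub>B\<^esub>"
  by simp

lemma alg_hom_minus: "\<lbrakk>x \<in> carrier A; y \<in> carrier A\<rbrakk> \<Longrightarrow> f (x \<ominus>\<^bsub>A\<^esub> y) = f x \<ominus>\<^bsub>B\<^esub> f y"
  by simp

end

section \<open>Subspaces, ideals and generated subalgebras\<close>

lemma subspaceI:
  assumes "vectorspace K V" and "W \<subseteq> carrier V" and "\<zero>\<^bsub>V\<^esub> \<in> W"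
    and "\<And>v w. \<lbrakk>v \<in> W; w \<in> W\<rbrakk> \<Longrightarrow> v \<oplus>\<^bsub>V\<^esub> w \<in> W"
    and "\<And>c v. \<lbrakk>c \<in> carrier K; v \<in> W\<rbrakk> \<Longrightarrow> c \<odot>\<^bsub>V\<^esub> v \<in> W"
  shows "VectorSpace.subspace K W V"
  using assms unfolding VectorSpace.subspace_def submodule_def by (auto simp: vectorspace.axioms)

lemma
  assumes "VectorSpace.subspace K W V"
  shows subspace_subset: "W \<subseteq> carrier V"
    and subspace_zero: "\<zero>\<^bsub>V\<^esub> \<in> W"
    and subspace_add: "\<And>v w. \<lbrakk>v \<in> W; w \<in> W\<rbrakk> \<Longrightarrow> v \<oplus>\<^bsub>V\<^esub> w \<in> W"
    and subspace_smult: "\<And>c v. \<lbrakk>c \<in> carrier K; v \<in> W\<rbrakk> \<Longrightarrow> c \<odot>\<^bsub>V\<^esub> v \<in> W"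
  using assms unfolding VectorSpace.subspace_def submodule_def by auto

text \<open>The axioms are equations, apart from the existence of negatives, whose witnesses are
  images of negatives in \<open>A\<close>. All of them pass along a surjection that respects the
  operations, so nothing is assumed of \<open>B\<close>, not even that it is a group.\<close>

lemma nonassoc_algebra_image:
  assumes A: "nonassoc_algebra K A" and surj: "carrier B = \<pi> ` carrier A" and zero: "\<zero>\<^bsub>B\<^esub> = \<pi> \<zero>\<^bsub>A\<^esub>"
    and add: "\<And>x y. \<lbrakk>x \<in> carrier A; y \<in> carrier A\<rbrakk> \<Longrightarrow> \<pi> (x \<oplus>\<^bsub>A\<^esub> y) = \<pi> x \<oplus>\<^bsub>B\<^esub> \<pi> y"
    and smult: "\<And>c x. \<lbrakk>c \<in> carrier K; x \<in> carrier A\<rbrakk> \<Longrightarrow> \<pi> (c \<odot>\<^bsub>A\<^esub> x) = c \<odot>\<^bsub>B\<^esub> \<pi> x"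
    and prod: "\<And>x y. \<lbrakk>x \<in> carrier A; y \<in> carrier A\<rbrakk> \<Longrightarrow> \<pi> (x \<otimes>\<^bsub>A\<^esub> y) = \<pi> x \<otimes>\<^bsub>B\<^esub> \<pi> y"
  shows "nonassoc_algebra K B"
proof -
  interpret A: nonassoc_algebra K A by fact
  note hom = add[symmetric] smult[symmetric] prod[symmetric]
  have "vectorspace K B"
  proof (rule vs_criteria)
    show "field K" by (rule A.field.field_axioms)
    show "\<forall>v\<in>carrier B. \<exists>neg_v\<in>carrier B. v \<oplus>\<^bsub>B\<^esub> neg_v = \<zero>\<^bsub>B\<^esub>"
      unfolding surj zero by (auto simp: hom intro!: bexI[of _ "\<ominus>\<^bsub>A\<^esub> _"] arg_cong[where f = \<pi>] A.M.r_neg)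
  qed (auto simp: surj zero hom A.M.a_ac A.smult_l_distr A.smult_r_distr A.smult_assoc1)
  then show ?thesis
    by (intro nonassoc_algebra.intro nonassoc_algebra_axioms.intro)
      (auto simp: surj hom A.prod_add_left A.prod_add_right A.prod_smult_left A.prod_smult_right)
qed

lemma subspace_add_inv:
  assumes "VectorSpace.subspace K W V" and "v \<in> W"
  shows "\<ominus>\<^bsub>V\<^esub> v \<in> W"
proof -
  interpret vectorspace K V
    using assms(1) by (rule VectorSpace.subspace.vs)
  have "\<ominus>\<^bsub>V\<^esub> v = (\<ominus>\<^bsub>K\<^esub> \<one>\<^bsub>K\<^esub>) \<odot>\<^bsub>V\<^esub> v"
    using subspace_subset[OF assms(1)] assms(2) by (auto simp: smult_minus_1)
  then show ?thesis
    using assms by (auto intro: subspace_smult)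
qed

lemma subspace_abelian_subgroup:
  assumes "VectorSpace.subspace K W V"
  shows "abelian_subgroup W V"
proof -
  interpret vectorspace K V
    using assms by (rule VectorSpace.subspace.vs)
  have "subgroup W (add_monoid V)"
    using subspace_subset[OF assms] subspace_zero[OF assms] subspace_add[OF assms]
      subspace_add_inv[OF assms]
    by (auto intro!: subgroup.intro simp: a_inv_def[symmetric])
  then show ?thesis
    by (intro abelian_subgroupI3 additive_subgroupI M.abelian_group_axioms)
qed

lemma
  assumes "alg_ideal K I A"
  shows alg_ideal_subspace: "VectorSpace.subspace K I A"
    and alg_ideal_prod_left: "\<lbrakk>x \<in> carrier A; y \<in> I\<rbrakk> \<Longrightarrow> x \<otimes>\<^bsub>A\<^esub> y \<in> I"
    and alg_ideal_prod_right: "\<lbrakk>x \<in> carrier A; y \<in> I\<rbrakk> \<Longrightarrow> y \<otimes>\<^bsub>A\<^esub> x \<in> I"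
  using assms by (auto simp: alg_ideal_def)

lemma
  assumes "subalg K S A"
  shows subalg_subspace: "VectorSpace.subspace K S A"
    and subalg_prod: "\<lbrakk>x \<in> S; y \<in> S\<rbrakk> \<Longrightarrow> x \<otimes>\<^bsub>A\<^esub> y \<in> S"
  using assms by (auto simp: subalg_def)

context nonassoc_algebra
begin

lemma prod_zero_left [simp]: "x \<in> carrier A \<Longrightarrow> \<zero> \<otimes> x = \<zero>"
  using prod_smult_left[of "\<zero>\<^bsub>K\<^esub>" "\<zero>" x] by simp

lemma prod_zero_right [simp]: "x \<in> carrier A \<Longrightarrow> x \<otimes> \<zero> = \<zero>"
  using prod_smult_right[of "\<zero>\<^bsub>K\<^esub>" x "\<zero>"] by simp

lemma prod_minus_left:
  "\<lbrakk>x \<in> carrier A; y \<in> carrier A; z \<in> carrier A\<rbrakk> \<Longrightarrow> (x \<ominus> y) \<otimes> z = x \<otimes> z \<ominus> y \<otimes> z"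
  using prod_smult_left[of "\<ominus>\<^bsub>K\<^esub> \<one>\<^bsub>K\<^esub>" y z] by (simp add: a_minus_def prod_add_left smult_minus_1)

lemma prod_minus_right:
  "\<lbrakk>x \<in> carrier A; y \<in> carrier A; z \<in> carrier A\<rbrakk> \<Longrightarrow> x \<otimes> (y \<ominus> z) = x \<otimes> y \<ominus> x \<otimes> z"
  using prod_smult_right[of "\<ominus>\<^bsub>K\<^esub> \<one>\<^bsub>K\<^esub>" x z] by (simp add: a_minus_def prod_add_right smult_minus_1)

lemma carrier_subspace: "VectorSpace.subspace K (carrier A) A"
  by (rule subspaceI) (auto intro: vectorspace_axioms)

lemma carrier_alg_ideal: "alg_ideal K (carrier A) A"
  by (simp add: alg_ideal_def carrier_subspace)

lemma carrier_subalg: "subalg K (carrier A) A"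
  by (simp add: subalg_def carrier_subspace)

text \<open>An empty intersection would be the whole type instead of \<open>carrier A\<close>. For
  generated ideals and subalgebras, \<open>carrier_alg_ideal\<close> and
  \<open>carrier_subalg\<close> supply a member of the family.\<close>

lemma subspace_Inter:
  assumes "\<C> \<noteq> {}" and "\<And>W. W \<in> \<C> \<Longrightarrow> VectorSpace.subspace K W A"
  shows "VectorSpace.subspace K (\<Inter>\<C>) A"
proof (rule subspaceI[OF vectorspace_axioms])
  show "\<Inter>\<C> \<subseteq> carrier A"
    using assms(1) subspace_subset[OF assms(2)] by (meson Inf_less_eq)
qed (auto intro: subspace_zero subspace_add subspace_smult assms(2))

lemma alg_ideal_gen_ideal:
  assumes "R \<subseteq> carrier A"
  shows "alg_ideal K (alg_ideal_gen K A R) A"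
proof -
  have "VectorSpace.subspace K (alg_ideal_gen K A R) A"
    unfolding alg_ideal_gen_def using assms carrier_alg_ideal
    by (intro subspace_Inter) (auto dest: alg_ideal_subspace)
  moreover have "x \<otimes> y \<in> alg_ideal_gen K A R" and "y \<otimes> x \<in> alg_ideal_gen K A R"
    if "x \<in> carrier A" and "y \<in> alg_ideal_gen K A R" for x y
    using that by (auto simp: alg_ideal_gen_def intro: alg_ideal_prod_left alg_ideal_prod_right)
  ultimately show ?thesis
    unfolding alg_ideal_def by blast
qed

lemma subalg_gen_subalg:
  assumes "G \<subseteq> carrier A"
  shows "subalg K (subalg_gen K A G) A"
proof -
  have "VectorSpace.subspace K (subalg_gen K A G) A"
    unfolding subalg_gen_def using assms carrier_subalg
    by (intro subspace_Inter) (auto dest: subalg_subspace)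
  moreover have "x \<otimes> y \<in> subalg_gen K A G"
    if "x \<in> subalg_gen K A G" and "y \<in> subalg_gen K A G" for x y
    using that by (auto simp: subalg_gen_def intro: subalg_prod)
  ultimately show ?thesis
    unfolding subalg_def by blast
qed

end

lemma alg_ideal_gen_superset: "R \<subseteq> alg_ideal_gen K A R"
  by (auto simp: alg_ideal_gen_def)

lemma alg_ideal_gen_least: "\<lbrakk>alg_ideal K I A; R \<subseteq> I\<rbrakk> \<Longrightarrow> alg_ideal_gen K A R \<subseteq> I"
  by (auto simp: alg_ideal_gen_def)

lemma subalg_gen_superset: "G \<subseteq> subalg_gen K A G"
  by (auto simp: subalg_gen_def)

lemma subalg_gen_least: "\<lbrakk>subalg K S A; G \<subseteq> S\<rbrakk> \<Longrightarrow> subalg_gen K A G \<subseteq> S"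
  by (auto simp: subalg_gen_def)

context
  fixes K :: "('k, 'r) ring_scheme" and A :: "('k, 'a, 'm) module_scheme" and B :: "('k, 'b, 'n) module_scheme"
  assumes A: "nonassoc_algebra K A" and B: "nonassoc_algebra K B"
begin

interpretation A: nonassoc_algebra K A by (rule A)
interpretation B: nonassoc_algebra K B by (rule B)

text \<open>Kernels, preimages and equalizers stand in for induction over generated elements: a
  generated ideal lies in a kernel, and a generated algebra equals a preimage or an equalizer, once
  the generators belong to it.\<close>

lemma alg_hom_kernel_ideal:
  assumes f: "f \<in> alg_hom K A B"
  shows "alg_ideal K {x \<in> carrier A. f x = \<zero>\<^bsub>B\<^esub>} A"
  unfolding alg_ideal_def
  by (auto intro!: subspaceI A.vectorspace_axioms simp: alg_hom_simps[OF f] alg_hom_zero[OF A.vectorspace_axioms B.vectorspace_axioms f])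

lemma alg_hom_vimage_subalg:
  assumes f: "f \<in> alg_hom K A B" and T: "subalg K T B"
  shows "subalg K {x \<in> carrier A. f x \<in> T} A"
  using subspace_zero[OF subalg_subspace[OF T]] subspace_add[OF subalg_subspace[OF T]]
    subspace_smult[OF subalg_subspace[OF T]] subalg_prod[OF T]
  unfolding subalg_def
  by (auto intro!: subspaceI A.vectorspace_axioms simp: alg_hom_simps[OF f] alg_hom_zero[OF A.vectorspace_axioms B.vectorspace_axioms f])

lemma alg_hom_equalizer_subalg:
  assumes f: "f \<in> alg_hom K A B" and g: "g \<in> alg_hom K A B"
  shows "subalg K {x \<in> carrier A. f x = g x} A"
  unfolding subalg_def
  by (auto intro!: subspaceI A.vectorspace_axioms
      simp: alg_hom_simps[OF f] alg_hom_simps[OF g] alg_hom_zero[OF A.vectorspace_axioms B.vectorspace_axioms f] alg_hom_zero[OF A.vectorspace_axioms B.vectorspace_axioms g])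

end

section \<open>Quotients by ideals and their universal property\<close>

context nonassoc_algebra
begin

context
  fixes I
  assumes I: "alg_ideal K I A"
begin

interpretation abelian_subgroup I A
  by (rule subspace_abelian_subgroup[OF alg_ideal_subspace[OF I]])

lemma coset_eq_iff:
  assumes "x \<in> carrier A" and "y \<in> carrier A"
  shows "I +> x = I +> y \<longleftrightarrow> x \<ominus> y \<in> I"
proof -
  have "I +> x = I +> y \<longleftrightarrow> x \<in> I +> y"
    using assms by (metis a_rcos_self a_repr_independence')
  then show ?thesis
    using assms by (simp add: a_rcos_module a_minus_def)
qed

lemma coset_mem:
  assumes "x \<in> carrier A" and "u \<in> I +> x"
  shows "u \<in> carrier A" and "u \<ominus> x \<in> I"
proof -
  show u: "u \<in> carrier A"
    using assms by (meson a_elemrcos_carrier)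
  show "u \<ominus> x \<in> I"
    using assms u by (simp add: a_rcos_module a_minus_def)
qed

lemma alg_quot_carrier: "carrier (alg_quot A I) = (\<lambda>x. I +> x) ` carrier A"
  by (auto simp: alg_quot_def A_RCOSETS_def')

lemma alg_quot_zero: "\<zero>\<^bsub>alg_quot A I\<^esub> = I +> \<zero>"
  using a_subset by (simp add: alg_quot_def)

lemma alg_quot_add:
  "\<lbrakk>x \<in> carrier A; y \<in> carrier A\<rbrakk> \<Longrightarrow> (I +> x) \<oplus>\<^bsub>alg_quot A I\<^esub> (I +> y) = I +> (x \<oplus> y)"
  by (simp add: alg_quot_def a_rcos_sum)

lemma alg_quot_smult:
  assumes "c \<in> carrier K" and "x \<in> carrier A"
  shows "c \<odot>\<^bsub>alg_quot A I\<^esub> (I +> x) = I +> (c \<odot> x)"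
proof -
  have "I +> (c \<odot> u) = I +> (c \<odot> x)" if "u \<in> I +> x" for u
  proof -
    have "c \<odot> u \<ominus> c \<odot> x = c \<odot> (u \<ominus> x)"
      using assms coset_mem[OF assms(2) that]
      by (simp add: a_minus_def smult_r_distr smult_r_minus)
    then show ?thesis
      using assms coset_mem[OF assms(2) that]
      by (simp add: coset_eq_iff subspace_smult[OF alg_ideal_subspace[OF I]])
  qed
  moreover have "I +> x \<noteq> {}"
    using a_rcos_self[OF assms(2)] by blast
  ultimately have "(\<Union>u\<in>I +> x. I +> (c \<odot> u)) = I +> (c \<odot> x)"
    by (intro SUP_eq_const)
  then show ?thesis
    by (simp only: alg_quot_def module.simps)
qed

lemma alg_quot_prod:
  assumes "x \<in> carrier A" and "y \<in> carrier A"
  shows "(I +> x) \<otimes>\<^bsub>alg_quot A I\<^esub> (I +> y) = I +> (x \<otimes> y)"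
proof -
  have "I +> (u \<otimes> v) = I +> (x \<otimes> y)" if "u \<in> I +> x" "v \<in> I +> y" for u v
  proof -
    note u = coset_mem[OF assms(1) that(1)] and v = coset_mem[OF assms(2) that(2)]
    have "u \<otimes> v \<ominus> x \<otimes> y = (u \<ominus> x) \<otimes> v \<oplus> x \<otimes> (v \<ominus> y)"
      using assms u v
      by (simp add: prod_minus_left prod_minus_right M.minus_add_minus)
    also have "\<dots> \<in> I"
      using assms u v
      by (intro subspace_add[OF alg_ideal_subspace[OF I]] alg_ideal_prod_left[OF I] alg_ideal_prod_right[OF I])
    finally show ?thesis
      using assms u(1) v(1) by (metis coset_eq_iff prod_closed)
  qed
  moreover have "I +> x \<noteq> {}" and "I +> y \<noteq> {}"
    using a_rcos_self[OF assms(1)] a_rcos_self[OF assms(2)] by blast+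
  ultimately have "(\<Union>u\<in>I +> x. \<Union>v\<in>I +> y. I +> (u \<otimes> v)) = I +> (x \<otimes> y)"
    by (intro SUP_eq_const)
  then show ?thesis
    by (simp only: alg_quot_def rcoset_mult_def monoid.simps)
qed

lemmas alg_quot_simps = alg_quot_carrier alg_quot_zero alg_quot_add alg_quot_smult alg_quot_prod

lemma nonassoc_algebra_quot: "nonassoc_algebra K (alg_quot A I)"
  by (rule nonassoc_algebra_image[OF nonassoc_algebra_axioms, of _ "\<lambda>x. I +> x"])
    (simp_all add: alg_quot_simps)

lemma alg_quot_proj_hom: "(\<lambda>x. I +> x) \<in> alg_hom K A (alg_quot A I)"
  by (rule alg_homI) (simp_all add: alg_quot_simps)

lemma alg_quot_lift:
  assumes B: "nonassoc_algebra K B" and f: "f \<in> alg_hom K A B" and ker: "\<And>x. x \<in> I \<Longrightarrow> f x = \<zero>\<^bsub>B\<^esub>"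
  shows "\<exists>g \<in> alg_hom K (alg_quot A I) B. \<forall>x \<in> carrier A. g (I +> x) = f x"
proof -
  interpret B: nonassoc_algebra K B by (rule B)
  \<comment> \<open>A coset is a bare set, so \<open>g\<close> evaluates \<open>f\<close> at a
    chosen representative; \<open>ker\<close> makes the value independent of the choice.\<close>
  define g where "g C = f (SOME x. x \<in> carrier A \<and> C = I +> x)" for C
  have g: "g (I +> x) = f x" if x: "x \<in> carrier A" for x
  proof -
    define y where "y = (SOME y. y \<in> carrier A \<and> I +> x = I +> y)"
    have y: "y \<in> carrier A" "I +> x = I +> y"
      using someI_ex[of "\<lambda>y. y \<in> carrier A \<and> I +> x = I +> y"] x unfolding y_def by auto
    then have "f (x \<ominus> y) = \<zero>\<^bsub>B\<^esub>"
      using x by (metis coset_eq_iff ker)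
    then have "f x \<ominus>\<^bsub>B\<^esub> f y = \<zero>\<^bsub>B\<^esub>"
      using x y alg_hom_minus[OF vectorspace_axioms B.vectorspace_axioms f] by metis
    then have "f x = f y"
      using x y alg_hom_closed[OF f] by (metis B.M.minus_eq_zero_imp_eq)
    then show ?thesis
      by (simp add: g_def y_def)
  qed
  have "g \<in> alg_hom K (alg_quot A I) B"
    by (rule alg_homI) (auto simp: alg_quot_simps g alg_hom_simps[OF f])
  with g show ?thesis
    by blast
qed

end

end

section \<open>Free algebras and presentations\<close>

definition free_word :: "('k, 'r) ring_scheme \<Rightarrow> 'x magma \<Rightarrow> 'x magma \<Rightarrow> 'k" where
  "free_word K w = (\<lambda>v. if v = w then \<one>\<^bsub>K\<^esub> else \<zero>\<^bsub>K\<^esub>)"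

lemma free_nonassoc_simps [simp]:
  "\<zero>\<^bsub>free_nonassoc K X\<^esub> = (\<lambda>w. \<zero>\<^bsub>K\<^esub>)"
  "p \<oplus>\<^bsub>free_nonassoc K X\<^esub> q = (\<lambda>w. p w \<oplus>\<^bsub>K\<^esub> q w)"
  "c \<odot>\<^bsub>free_nonassoc K X\<^esub> p = (\<lambda>w. c \<otimes>\<^bsub>K\<^esub> p w)"
  "p \<otimes>\<^bsub>free_nonassoc K X\<^esub> q = (\<lambda>w. case w of Letter x \<Rightarrow> \<zero>\<^bsub>K\<^esub> | Prod u v \<Rightarrow> p u \<otimes>\<^bsub>K\<^esub> q v)"
  by (simp_all add: free_nonassoc_def)

lemma free_nonassoc_carrierI:
  assumes "\<And>w. p w \<in> carrier K" and "finite {w. p w \<noteq> \<zero>\<^bsub>K\<^esub>}"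
    and "\<And>w. p w \<noteq> \<zero>\<^bsub>K\<^esub> \<Longrightarrow> set_magma w \<subseteq> X"
  shows "p \<in> carrier (free_nonassoc K X)"
  using assms by (simp add: free_nonassoc_def)

lemma
  assumes "p \<in> carrier (free_nonassoc K X)"
  shows free_nonassoc_coeff [intro]: "p w \<in> carrier K"
    and free_nonassoc_finite: "finite {w. p w \<noteq> \<zero>\<^bsub>K\<^esub>}"
    and free_nonassoc_letters: "p w \<noteq> \<zero>\<^bsub>K\<^esub> \<Longrightarrow> set_magma w \<subseteq> X"
  using assms by (auto simp: free_nonassoc_def)

context field
begin

lemma free_nonassoc_add_carrier:
  assumes "p \<in> carrier (free_nonassoc R X)" and "q \<in> carrier (free_nonassoc R X)"
  shows "(\<lambda>w. p w \<oplus> q w) \<in> carrier (free_nonassoc R X)"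
proof (rule free_nonassoc_carrierI)
  have "{w. p w \<oplus> q w \<noteq> \<zero>} \<subseteq> {w. p w \<noteq> \<zero>} \<union> {w. q w \<noteq> \<zero>}"
    by auto
  then show "finite {w. p w \<oplus> q w \<noteq> \<zero>}"
    using free_nonassoc_finite[OF assms(1)] free_nonassoc_finite[OF assms(2)]
    by (auto intro: finite_subset)
  show "set_magma w \<subseteq> X" if "p w \<oplus> q w \<noteq> \<zero>" for w
    using that free_nonassoc_letters[OF assms(1), of w] free_nonassoc_letters[OF assms(2), of w]
    by (cases "p w = \<zero>") (auto simp: free_nonassoc_coeff[OF assms(2)])
qed (use assms in auto)

lemma free_nonassoc_smult_carrier:
  assumes "c \<in> carrier R" and "p \<in> carrier (free_nonassoc R X)"
  shows "(\<lambda>w. c \<otimes> p w) \<in> carrier (free_nonassoc R X)"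
proof (rule free_nonassoc_carrierI)
  have "{w. c \<otimes> p w \<noteq> \<zero>} \<subseteq> {w. p w \<noteq> \<zero>}"
    using assms by auto
  then show "finite {w. c \<otimes> p w \<noteq> \<zero>}"
    using free_nonassoc_finite[OF assms(2)] by (auto intro: finite_subset)
  show "set_magma w \<subseteq> X" if "c \<otimes> p w \<noteq> \<zero>" for w
    using that assms(1) free_nonassoc_letters[OF assms(2), of w]
    by (cases "p w = \<zero>") auto
qed (use assms in auto)

lemma free_nonassoc_prod_carrier:
  assumes p: "p \<in> carrier (free_nonassoc R X)" and q: "q \<in> carrier (free_nonassoc R X)"
  shows "p \<otimes>\<^bsub>free_nonassoc R X\<^esub> q \<in> carrier (free_nonassoc R X)"
proof (rule free_nonassoc_carrierI)
  note carr = free_nonassoc_coeff[OF p] free_nonassoc_coeff[OF q]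
  have nz: "\<exists>u v. w = Prod u v \<and> p u \<noteq> \<zero> \<and> q v \<noteq> \<zero>"
    if "(p \<otimes>\<^bsub>free_nonassoc R X\<^esub> q) w \<noteq> \<zero>" for w
    using that carr by (cases w) auto
  then have "{w. (p \<otimes>\<^bsub>free_nonassoc R X\<^esub> q) w \<noteq> \<zero>}
      \<subseteq> (\<lambda>(u, v). Prod u v) ` ({u. p u \<noteq> \<zero>} \<times> {v. q v \<noteq> \<zero>})"
    by fastforce
  then show "finite {w. (p \<otimes>\<^bsub>free_nonassoc R X\<^esub> q) w \<noteq> \<zero>}"
    using free_nonassoc_finite[OF p] free_nonassoc_finite[OF q] by (auto intro: finite_subset)
  show "set_magma w \<subseteq> X" if "(p \<otimes>\<^bsub>free_nonassoc R X\<^esub> q) w \<noteq> \<zero>" for w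
    using nz[OF that] free_nonassoc_letters[OF p] free_nonassoc_letters[OF q] by fastforce
  show "(p \<otimes>\<^bsub>free_nonassoc R X\<^esub> q) w \<in> carrier R" for w
    using carr by (cases w) auto
qed

lemma nonassoc_algebra_free: "nonassoc_algebra R (free_nonassoc R X)"
proof -
  let ?F = "free_nonassoc R X"
  note coeff [simp] = free_nonassoc_coeff
  have "vectorspace R ?F"
  proof (rule vs_criteria)
    show "\<forall>p\<in>carrier ?F. \<exists>q\<in>carrier ?F. p \<oplus>\<^bsub>?F\<^esub> q = \<zero>\<^bsub>?F\<^esub>"
    proof
      fix p assume p: "p \<in> carrier ?F"
      then have "(\<lambda>w. (\<ominus> \<one>) \<otimes> p w) \<in> carrier ?F"
        by (intro free_nonassoc_smult_carrier) auto
      moreover have "p w \<oplus> (\<ominus> \<one>) \<otimes> p w = \<zero>" for w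
        using free_nonassoc_coeff[OF p, of w] by (simp add: l_minus r_neg)
      ultimately show "\<exists>q\<in>carrier ?F. p \<oplus>\<^bsub>?F\<^esub> q = \<zero>\<^bsub>?F\<^esub>"
        by (intro bexI[of _ "\<lambda>w. (\<ominus> \<one>) \<otimes> p w"]) simp_all
    qed
    show "\<zero>\<^bsub>?F\<^esub> \<in> carrier ?F"
      by (rule free_nonassoc_carrierI) auto
  qed (auto simp: free_nonassoc_add_carrier free_nonassoc_smult_carrier a_ac m_assoc l_distr r_distr
      field_axioms)
  then show ?thesis
    by (intro nonassoc_algebra.intro nonassoc_algebra_axioms.intro)
      (auto simp: free_nonassoc_prod_carrier l_distr r_distr m_ac simp del: free_nonassoc_simps(4),
       auto simp: fun_eq_iff l_distr r_distr m_ac split: magma.split)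
qed

lemma free_word_carrier:
  assumes "set_magma w \<subseteq> X"
  shows "free_word R w \<in> carrier (free_nonassoc R X)"
proof (rule free_nonassoc_carrierI)
  show "finite {v. free_word R w v \<noteq> \<zero>}"
    by (rule finite_subset[of _ "{w}"]) (auto simp: free_word_def)
qed (use assms in \<open>auto simp: free_word_def split: if_splits\<close>)

lemma free_word_Prod: "free_word R (Prod u v) = free_word R u \<otimes>\<^bsub>free_nonassoc R X\<^esub> free_word R v"
  by (auto simp: free_word_def fun_eq_iff split: magma.split)

text \<open>Words span: induction on the support removes one word \<open>w\<close> together with its
  coefficient \<open>p w\<close>. Linear statements about the free algebra are later checked on
  words by means of this lemma.\<close>

lemma free_nonassoc_subspace_eq:
  assumes W: "VectorSpace.subspace R W (free_nonassoc R X)"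
    and words: "\<And>w. set_magma w \<subseteq> X \<Longrightarrow> free_word R w \<in> W"
  shows "W = carrier (free_nonassoc R X)"
proof (rule antisym[OF subspace_subset[OF W]])
  let ?F = "free_nonassoc R X"
  have "p \<in> W" if "finite S" "p \<in> carrier ?F" "{w. p w \<noteq> \<zero>} = S" for S p
    using that
  proof (induction S arbitrary: p rule: finite_induct)
    case empty
    then have "p = \<zero>\<^bsub>?F\<^esub>"
      by auto
    then show ?case
      using subspace_zero[OF W] by simp
  next
    case (insert w S)
    note coeff = free_nonassoc_coeff[OF insert.prems(1)]
    define q where "q = p(w := \<zero>)"
    have "{v. q v \<noteq> \<zero>} = S"
      using insert.hyps(2) insert.prems(2) by (auto simp: q_def)
    moreover have "q \<in> carrier ?F"
      using insert.hyps(1) coeff free_nonassoc_letters[OF insert.prems(1)] \<open>{v. q v \<noteq> \<zero>} = S\<close>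
      by (intro free_nonassoc_carrierI) (auto simp: q_def split: if_splits)
    ultimately have "q \<in> W"
      by (rule insert.IH[rotated])
    moreover have "free_word R w \<in> W"
      using insert.prems(2) free_nonassoc_letters[OF insert.prems(1), of w] by (intro words) auto
    ultimately have "q \<oplus>\<^bsub>?F\<^esub> p w \<odot>\<^bsub>?F\<^esub> free_word R w \<in> W"
      using coeff by (intro subspace_add[OF W] subspace_smult[OF W])
    moreover have "q \<oplus>\<^bsub>?F\<^esub> p w \<odot>\<^bsub>?F\<^esub> free_word R w = p"
      using coeff by (auto simp: q_def free_word_def)
    ultimately show ?case
      by simp
  qed
  then show "carrier ?F \<subseteq> W"
    using free_nonassoc_finite by blast
qed

lemma free_nonassoc_subalg_eq:
  assumes S: "subalg R S (free_nonassoc R X)"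
    and letters: "\<And>x. x \<in> X \<Longrightarrow> free_word R (Letter x) \<in> S"
  shows "S = carrier (free_nonassoc R X)"
proof (rule free_nonassoc_subspace_eq[OF subalg_subspace[OF S]])
  show "free_word R w \<in> S" if "set_magma w \<subseteq> X" for w
    using that
  proof (induction w)
    case (Prod u v)
    then show ?case
      using subalg_prod[OF S, of "free_word R u" "free_word R v"] by (simp add: free_word_Prod[of u v X] del: free_nonassoc_simps)
  qed (simp add: letters)
qed

end

primrec magma_eval :: "('k, 'b, 'm) module_scheme \<Rightarrow> ('x \<Rightarrow> 'b) \<Rightarrow> 'x magma \<Rightarrow> 'b" where
  "magma_eval B f (Letter x) = f x"
| "magma_eval B f (Prod u v) = magma_eval B f u \<otimes>\<^bsub>B\<^esub> magma_eval B f v"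

lemma free_nonassoc_lift:
  assumes B: "nonassoc_algebra K B" and f: "f \<in> X \<rightarrow> carrier B"
  shows "\<exists>h \<in> alg_hom K (free_nonassoc K X) B. \<forall>x \<in> X. h (free_word K (Letter x)) = f x"
proof -
  interpret B: nonassoc_algebra K B by (rule B)
  interpret F: nonassoc_algebra K "free_nonassoc K X" by (rule B.field.nonassoc_algebra_free)
  let ?F = "free_nonassoc K X"
  \<comment> \<open>With the default zero outside \<open>X\<close>, every word evaluates into
    \<open>carrier B\<close>, so the sums below may run over any finite set of words.\<close>
  define f' where "f' x = (if x \<in> X then f x else \<zero>\<^bsub>B\<^esub>)" for x
  let ?ev = "magma_eval B f'"
  have ev [simp]: "?ev w \<in> carrier B" for w
    by (induction w) (use f in \<open>auto simp: f'_def\<close>)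
  note coeff [simp] = free_nonassoc_coeff
  define h where "h p = (\<Oplus>\<^bsub>B\<^esub>w\<in>{w. p w \<noteq> \<zero>\<^bsub>K\<^esub>}. p w \<odot>\<^bsub>B\<^esub> ?ev w)" for p
  \<comment> \<open>The index set in \<open>h\<close> is the support and changes with
    \<open>p\<close>. Enlarging it to a common finite set allows sums for different elements to be
    compared term by term.\<close>
  have h_eq: "h p = (\<Oplus>\<^bsub>B\<^esub>w\<in>S. p w \<odot>\<^bsub>B\<^esub> ?ev w)"
    if "p \<in> carrier ?F" "finite S" "{w. p w \<noteq> \<zero>\<^bsub>K\<^esub>} \<subseteq> S" for p S
    unfolding h_def using that by (intro B.M.add.finprod_mono_neutral_cong_left) auto
  have add: "h (p \<oplus>\<^bsub>?F\<^esub> q) = h p \<oplus>\<^bsub>B\<^esub> h q" if pq: "p \<in> carrier ?F" "q \<in> carrier ?F" for p q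
  proof -
    let ?S = "{w. p w \<noteq> \<zero>\<^bsub>K\<^esub>} \<union> {w. q w \<noteq> \<zero>\<^bsub>K\<^esub>}"
    have fin: "finite ?S"
      using pq by (simp add: free_nonassoc_finite)
    have "p \<oplus>\<^bsub>?F\<^esub> q \<in> carrier ?F"
      using pq by (rule F.M.a_closed)
    moreover have "{w. (p \<oplus>\<^bsub>?F\<^esub> q) w \<noteq> \<zero>\<^bsub>K\<^esub>} \<subseteq> ?S"
      by auto
    ultimately have "h (p \<oplus>\<^bsub>?F\<^esub> q) = (\<Oplus>\<^bsub>B\<^esub>w\<in>?S. (p w \<oplus>\<^bsub>K\<^esub> q w) \<odot>\<^bsub>B\<^esub> ?ev w)"
      using h_eq[OF _ fin] by simp
    also have "\<dots> = (\<Oplus>\<^bsub>B\<^esub>w\<in>?S. p w \<odot>\<^bsub>B\<^esub> ?ev w \<oplus>\<^bsub>B\<^esub> q w \<odot>\<^bsub>B\<^esub> ?ev w)"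
      using pq by (intro B.M.add.finprod_cong') (auto simp: B.smult_l_distr)
    also have "\<dots> = h p \<oplus>\<^bsub>B\<^esub> h q"
      using pq by (subst B.M.finsum_addf) (auto simp: h_eq[OF _ fin])
    finally show ?thesis .
  qed
  have smult: "h (c \<odot>\<^bsub>?F\<^esub> p) = c \<odot>\<^bsub>B\<^esub> h p" if cp: "c \<in> carrier K" "p \<in> carrier ?F" for c p
  proof -
    let ?S = "{w. p w \<noteq> \<zero>\<^bsub>K\<^esub>}"
    have fin: "finite ?S"
      using cp by (simp add: free_nonassoc_finite)
    have "c \<odot>\<^bsub>?F\<^esub> p \<in> carrier ?F"
      using cp by (rule F.smult_closed)
    moreover have "{w. (c \<odot>\<^bsub>?F\<^esub> p) w \<noteq> \<zero>\<^bsub>K\<^esub>} \<subseteq> ?S"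
      using cp by auto
    ultimately have "h (c \<odot>\<^bsub>?F\<^esub> p) = (\<Oplus>\<^bsub>B\<^esub>w\<in>?S. (c \<otimes>\<^bsub>K\<^esub> p w) \<odot>\<^bsub>B\<^esub> ?ev w)"
      using h_eq[OF _ fin] by simp
    also have "\<dots> = (\<Oplus>\<^bsub>B\<^esub>w\<in>?S. c \<odot>\<^bsub>B\<^esub> (p w \<odot>\<^bsub>B\<^esub> ?ev w))"
      using cp by (intro B.M.add.finprod_cong') (auto simp: B.smult_assoc1)
    also have "\<dots> = c \<odot>\<^bsub>B\<^esub> h p"
      unfolding h_def using cp by (subst B.finsum_smult) auto
    finally show ?thesis .
  qed
  have closed: "h p \<in> carrier B" if "p \<in> carrier ?F" for p
    unfolding h_def using that by (intro B.M.finsum_closed) auto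
  have word: "h (free_word K w) = ?ev w" if "set_magma w \<subseteq> X" for w
  proof -
    have "h (free_word K w) = (\<Oplus>\<^bsub>B\<^esub>v\<in>{w}. free_word K w v \<odot>\<^bsub>B\<^esub> ?ev v)"
      using that by (intro h_eq B.field.free_word_carrier) (auto simp: free_word_def)
    then show ?thesis
      by (simp add: free_word_def)
  qed
  have h0: "h \<zero>\<^bsub>?F\<^esub> = \<zero>\<^bsub>B\<^esub>"
    by (simp add: h_def)
  \<comment> \<open>Both sides of the product rule are bilinear, so it is extended from words in one
    argument at a time; this avoids a double sum over supports.\<close>
  have word_prod: "h (free_word K u \<otimes>\<^bsub>?F\<^esub> q) = h (free_word K u) \<otimes>\<^bsub>B\<^esub> h q"
    if u: "set_magma u \<subseteq> X" and q: "q \<in> carrier ?F" for u q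
  proof -
    let ?W = "{q \<in> carrier ?F. h (free_word K u \<otimes>\<^bsub>?F\<^esub> q) = h (free_word K u) \<otimes>\<^bsub>B\<^esub> h q}"
    have fu: "free_word K u \<in> carrier ?F"
      using u by (rule B.field.free_word_carrier)
    have "?W = carrier ?F"
    proof (rule B.field.free_nonassoc_subspace_eq[OF subspaceI[OF F.vectorspace_axioms]])
      show "free_word K v \<in> ?W" if "set_magma v \<subseteq> X" for v
        using that u B.field.free_word_carrier[OF that]
        by (auto simp: B.field.free_word_Prod[symmetric] word simp del: free_nonassoc_simps)
    qed (auto simp: fu F.prod_add_right F.prod_smult_right B.prod_add_right B.prod_smult_right
        add smult closed h0 simp del: free_nonassoc_simps)
    then show ?thesis
      using q by blast
  qed
  have prod: "h (p \<otimes>\<^bsub>?F\<^esub> q) = h p \<otimes>\<^bsub>B\<^esub> h q" if p: "p \<in> carrier ?F" and q: "q \<in> carrier ?F" for p q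
  proof -
    let ?W = "{p \<in> carrier ?F. h (p \<otimes>\<^bsub>?F\<^esub> q) = h p \<otimes>\<^bsub>B\<^esub> h q}"
    have "?W = carrier ?F"
    proof (rule B.field.free_nonassoc_subspace_eq[OF subspaceI[OF F.vectorspace_axioms]])
      show "free_word K v \<in> ?W" if "set_magma v \<subseteq> X" for v
        using that word_prod[OF that q] B.field.free_word_carrier[OF that] by simp
    qed (auto simp: q F.prod_add_left F.prod_smult_left B.prod_add_left B.prod_smult_left
        add smult closed h0 simp del: free_nonassoc_simps)
    then show ?thesis
      using p by blast
  qed
  have "h \<in> alg_hom K ?F B"
    by (rule alg_homI) (auto simp: closed add smult prod simp del: free_nonassoc_simps)
  moreover have "h (free_word K (Letter x)) = f x" if "x \<in> X" for x
    using that by (simp add: word f'_def)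
  ultimately show ?thesis
    by blast
qed

section \<open>Free Lie algebras and presentations by generators and relators\<close>

lemma lie_algebraI:
  assumes "nonassoc_algebra K L"
    and "\<And>x. x \<in> carrier L \<Longrightarrow> x \<otimes>\<^bsub>L\<^esub> x = \<zero>\<^bsub>L\<^esub>"
    and "\<And>x y z. \<lbrakk>x \<in> carrier L; y \<in> carrier L; z \<in> carrier L\<rbrakk> \<Longrightarrow>
      x \<otimes>\<^bsub>L\<^esub> (y \<otimes>\<^bsub>L\<^esub> z) \<oplus>\<^bsub>L\<^esub> y \<otimes>\<^bsub>L\<^esub> (z \<otimes>\<^bsub>L\<^esub> x) \<oplus>\<^bsub>L\<^esub> z \<otimes>\<^bsub>L\<^esub> (x \<otimes>\<^bsub>L\<^esub> y) = \<zero>\<^bsub>L\<^esub>"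
  shows "lie_algebra K L"
proof -
  interpret nonassoc_algebra K L by fact
  show ?thesis
    using assms(2,3)
    by unfold_locales (auto simp: prod_add_left prod_add_right prod_smult_left prod_smult_right)
qed

lemma (in lie_algebra) bracket_anticomm:
  assumes "x \<in> carrier L" and "y \<in> carrier L"
  shows "x \<otimes> y = \<ominus> (y \<otimes> x)"
proof -
  have "x \<otimes> y \<oplus> y \<otimes> x = (x \<oplus> y) \<otimes> (x \<oplus> y)"
    using assms by (subst prod_add_left) (simp_all add: prod_add_right bracket_self[of x] bracket_self[of y])
  also have "\<dots> = \<zero>"
    using assms by (intro bracket_self) auto
  finally show ?thesis
    using assms by (intro M.minus_equality[symmetric]) auto
qed

lemma (in lie_algebra) lie_algebra_quot:
  assumes I: "alg_ideal K I L"
  shows "lie_algebra K (alg_quot L I)"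
  by (rule lie_algebraI[OF nonassoc_algebra_quot[OF I]])
    (auto simp: alg_quot_simps[OF I] bracket_self jacobi)

context
  fixes K :: "('k, 'r) ring_scheme" and X :: "'x set"
  assumes K: "field K"
begin

interpretation K: field K by (rule K)
interpretation F: nonassoc_algebra K "free_nonassoc K X" by (rule K.nonassoc_algebra_free)

lemma free_nonassoc_gen_carrier: "x \<in> X \<Longrightarrow> free_word K (Letter x) \<in> carrier (free_nonassoc K X)"
  by (rule K.free_word_carrier) simp

context
  notes [simp del] = free_nonassoc_simps
begin

lemma lie_axioms_ideal: "alg_ideal K (lie_axioms_ideal K X) (free_nonassoc K X)"
  unfolding lie_axioms_ideal_def Let_def by (rule F.alg_ideal_gen_ideal) auto

lemma lie_algebra_free_lie: "lie_algebra K (free_lie K X)"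
proof -
  let ?F = "free_nonassoc K X" and ?I = "lie_axioms_ideal K X"
  let ?Q = "\<lambda>p. ?I +>\<^bsub>?F\<^esub> p"
  note I = lie_axioms_ideal
  note quot_simps = F.alg_quot_simps[OF I]
  have self: "p \<otimes>\<^bsub>?F\<^esub> p \<in> ?I" if "p \<in> carrier ?F" for p
    unfolding lie_axioms_ideal_def Let_def
    by (rule subsetD[OF alg_ideal_gen_superset]) (use that in auto)
  have jac: "p \<otimes>\<^bsub>?F\<^esub> (q \<otimes>\<^bsub>?F\<^esub> r) \<oplus>\<^bsub>?F\<^esub> q \<otimes>\<^bsub>?F\<^esub> (r \<otimes>\<^bsub>?F\<^esub> p) \<oplus>\<^bsub>?F\<^esub> r \<otimes>\<^bsub>?F\<^esub> (p \<otimes>\<^bsub>?F\<^esub> q) \<in> ?I"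
    if "p \<in> carrier ?F" "q \<in> carrier ?F" "r \<in> carrier ?F" for p q r
    unfolding lie_axioms_ideal_def Let_def
    by (rule subsetD[OF alg_ideal_gen_superset]) (use that in blast)
  have zero: "?I +>\<^bsub>?F\<^esub> p = ?I +>\<^bsub>?F\<^esub> \<zero>\<^bsub>?F\<^esub>" if "p \<in> ?I" for p
  proof -
    have "p \<in> carrier ?F"
      using that subspace_subset[OF alg_ideal_subspace[OF I]] by blast
    then show ?thesis
      using that by (simp add: F.coset_eq_iff[OF I] F.M.minus_zero_right)
  qed
  have "?Q p \<otimes>\<^bsub>alg_quot ?F ?I\<^esub> ?Q p = \<zero>\<^bsub>alg_quot ?F ?I\<^esub>" if "p \<in> carrier ?F" for p
    using that by (simp only: quot_simps zero[OF self])
  moreover have "?Q p \<otimes>\<^bsub>alg_quot ?F ?I\<^esub> (?Q q \<otimes>\<^bsub>alg_quot ?F ?I\<^esub> ?Q r) \<oplus>\<^bsub>alg_quot ?F ?I\<^esub>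
      ?Q q \<otimes>\<^bsub>alg_quot ?F ?I\<^esub> (?Q r \<otimes>\<^bsub>alg_quot ?F ?I\<^esub> ?Q p) \<oplus>\<^bsub>alg_quot ?F ?I\<^esub>
      ?Q r \<otimes>\<^bsub>alg_quot ?F ?I\<^esub> (?Q p \<otimes>\<^bsub>alg_quot ?F ?I\<^esub> ?Q q) = \<zero>\<^bsub>alg_quot ?F ?I\<^esub>"
    if "p \<in> carrier ?F" "q \<in> carrier ?F" "r \<in> carrier ?F" for p q r
    using that by (simp only: quot_simps F.prod_closed F.M.a_closed zero[OF jac])
  ultimately show ?thesis
    unfolding free_lie_def using F.nonassoc_algebra_quot[OF I]
    by (intro lie_algebraI) (auto simp only: F.alg_quot_carrier[OF I])
qed

interpretation L: lie_algebra K "free_lie K X" by (rule lie_algebra_free_lie)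

lemma free_lie_gen_eq: "free_lie_gen K X x = lie_axioms_ideal K X +>\<^bsub>free_nonassoc K X\<^esub> free_word K (Letter x)"
  by (simp add: free_lie_gen_def free_word_def)

lemma free_lie_gen_carrier: "x \<in> X \<Longrightarrow> free_lie_gen K X x \<in> carrier (free_lie K X)"
  by (auto simp: free_lie_gen_eq free_lie_def F.alg_quot_carrier[OF lie_axioms_ideal] free_nonassoc_gen_carrier)

text \<open>The extension to the free nonassociative algebra factors: its kernel is an ideal, and it
  contains all squares and Jacobi sums because \<open>B\<close> is a Lie algebra.\<close>

lemma free_lie_lift:
  assumes B: "lie_algebra K B" and f: "f \<in> X \<rightarrow> carrier B"
  shows "\<exists>h \<in> alg_hom K (free_lie K X) B. \<forall>x \<in> X. h (free_lie_gen K X x) = f x"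
proof -
  interpret B: lie_algebra K B by (rule B)
  let ?F = "free_nonassoc K X"
  obtain h where h: "h \<in> alg_hom K ?F B" and hx: "\<And>x. x \<in> X \<Longrightarrow> h (free_word K (Letter x)) = f x"
    using free_nonassoc_lift[OF B.nonassoc_algebra_axioms f] by blast
  have "lie_axioms_ideal K X \<subseteq> {p \<in> carrier ?F. h p = \<zero>\<^bsub>B\<^esub>}"
    unfolding lie_axioms_ideal_def Let_def
  proof (rule alg_ideal_gen_least)
    show "alg_ideal K {p \<in> carrier ?F. h p = \<zero>\<^bsub>B\<^esub>} ?F"
      by (rule alg_hom_kernel_ideal[OF F.nonassoc_algebra_axioms B.nonassoc_algebra_axioms h])
  qed (auto simp: alg_hom_simps[OF h] B.bracket_self B.jacobi)
  then obtain g where "g \<in> alg_hom K (alg_quot ?F (lie_axioms_ideal K X)) B"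
    and "\<And>p. p \<in> carrier ?F \<Longrightarrow> g (lie_axioms_ideal K X +>\<^bsub>?F\<^esub> p) = h p"
    using F.alg_quot_lift[OF lie_axioms_ideal B.nonassoc_algebra_axioms h] by blast
  then show ?thesis
    using hx free_nonassoc_gen_carrier unfolding free_lie_gen_eq free_lie_def by metis
qed

text \<open>Generation descends along the projection: the preimage of \<open>S\<close> is a
  subalgebra that contains all letters, hence everything.\<close>

lemma free_lie_subalg_eq:
  assumes S: "subalg K S (free_lie K X)" and gens: "\<And>x. x \<in> X \<Longrightarrow> free_lie_gen K X x \<in> S"
  shows "S = carrier (free_lie K X)"
proof (rule antisym[OF subspace_subset[OF subalg_subspace[OF S]]])
  let ?F = "free_nonassoc K X" and ?pi = "\<lambda>p. lie_axioms_ideal K X +>\<^bsub>free_nonassoc K X\<^esub> p"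
  have pi: "?pi \<in> alg_hom K ?F (free_lie K X)"
    unfolding free_lie_def by (rule F.alg_quot_proj_hom[OF lie_axioms_ideal])
  have "{p \<in> carrier ?F. ?pi p \<in> S} = carrier ?F"
    using alg_hom_vimage_subalg[OF F.nonassoc_algebra_axioms L.nonassoc_algebra_axioms pi S]
    by (rule K.free_nonassoc_subalg_eq)
      (simp add: free_nonassoc_gen_carrier gens flip: free_lie_gen_eq)
  then show "carrier (free_lie K X) \<subseteq> S"
    unfolding free_lie_def F.alg_quot_carrier[OF lie_axioms_ideal] by blast
qed

context
  fixes R
  assumes R: "R \<subseteq> carrier (free_lie K X)"
begin

lemma relators_ideal: "alg_ideal K (alg_ideal_gen K (free_lie K X) R) (free_lie K X)"
  using R by (rule L.alg_ideal_gen_ideal)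

lemma lie_algebra_lie_pres: "lie_algebra K (lie_pres K X R)"
  unfolding lie_pres_def by (rule L.lie_algebra_quot[OF relators_ideal])

interpretation P: lie_algebra K "lie_pres K X R" by (rule lie_algebra_lie_pres)

lemma lie_pres_proj_hom:
  "(\<lambda>u. alg_ideal_gen K (free_lie K X) R +>\<^bsub>free_lie K X\<^esub> u) \<in> alg_hom K (free_lie K X) (lie_pres K X R)"
  unfolding lie_pres_def by (rule L.alg_quot_proj_hom[OF relators_ideal])

lemma lie_pres_gen_carrier: "x \<in> X \<Longrightarrow> lie_pres_gen K X R x \<in> carrier (lie_pres K X R)"
  unfolding lie_pres_gen_def by (intro alg_hom_closed[OF lie_pres_proj_hom] free_lie_gen_carrier)

lemma lie_pres_relator:
  assumes "r \<in> R"
  shows "alg_ideal_gen K (free_lie K X) R +>\<^bsub>free_lie K X\<^esub> r = \<zero>\<^bsub>lie_pres K X R\<^esub>"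
proof -
  have "r \<in> alg_ideal_gen K (free_lie K X) R" and "r \<in> carrier (free_lie K X)"
    using subsetD[OF alg_ideal_gen_superset assms] subsetD[OF R assms] by auto
  then show ?thesis
    unfolding lie_pres_def
    by (simp add: L.alg_quot_zero[OF relators_ideal] L.coset_eq_iff[OF relators_ideal] L.M.minus_zero_right)
qed

lemma lie_pres_gen_bracket:
  assumes "x \<in> X" and "y \<in> X" and "free_lie_gen K X x \<otimes>\<^bsub>free_lie K X\<^esub> free_lie_gen K X y \<in> R"
  shows "lie_pres_gen K X R x \<otimes>\<^bsub>lie_pres K X R\<^esub> lie_pres_gen K X R y = \<zero>\<^bsub>lie_pres K X R\<^esub>"
  unfolding lie_pres_gen_def lie_pres_relator[OF assms(3), symmetric]
  by (rule alg_hom_prod[OF lie_pres_proj_hom, symmetric]) (simp_all add: assms free_lie_gen_carrier)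

text \<open>Relators are cosets, so their value under \<open>f\<close> can be expressed only through
  a homomorphism extending \<open>f\<close>. Hence \<open>rel\<close> is stated for an arbitrary
  such \<open>h\<close>, and each application computes \<open>h r\<close> from the values on the
  generators.\<close>

lemma lie_pres_lift:
  assumes B: "lie_algebra K B" and f: "f \<in> X \<rightarrow> carrier B"
    and rel: "\<And>h r. \<lbrakk>h \<in> alg_hom K (free_lie K X) B; \<And>x. x \<in> X \<Longrightarrow> h (free_lie_gen K X x) = f x; r \<in> R\<rbrakk> \<Longrightarrow>
      h r = \<zero>\<^bsub>B\<^esub>"
  shows "\<exists>h \<in> alg_hom K (lie_pres K X R) B. \<forall>x \<in> X. h (lie_pres_gen K X R x) = f x"
proof -
  interpret B: lie_algebra K B by (rule B)
  let ?F = "free_lie K X" and ?I = "alg_ideal_gen K (free_lie K X) R"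
  obtain h where h: "h \<in> alg_hom K ?F B" and hx: "\<And>x. x \<in> X \<Longrightarrow> h (free_lie_gen K X x) = f x"
    using free_lie_lift[OF B f] by blast
  have "?I \<subseteq> {p \<in> carrier ?F. h p = \<zero>\<^bsub>B\<^esub>}"
  proof (rule alg_ideal_gen_least)
    show "alg_ideal K {p \<in> carrier ?F. h p = \<zero>\<^bsub>B\<^esub>} ?F"
      by (rule alg_hom_kernel_ideal[OF L.nonassoc_algebra_axioms B.nonassoc_algebra_axioms h])
    show "R \<subseteq> {p \<in> carrier ?F. h p = \<zero>\<^bsub>B\<^esub>}"
      using R rel[OF h hx] by blast
  qed
  then obtain g where "g \<in> alg_hom K (alg_quot ?F ?I) B"
    and "\<And>p. p \<in> carrier ?F \<Longrightarrow> g (?I +>\<^bsub>?F\<^esub> p) = h p"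
    using L.alg_quot_lift[OF relators_ideal B.nonassoc_algebra_axioms h] by blast
  then show ?thesis
    using hx free_lie_gen_carrier unfolding lie_pres_gen_def lie_pres_def by metis
qed

lemma lie_pres_subalg_eq:
  assumes S: "subalg K S (lie_pres K X R)" and gens: "\<And>x. x \<in> X \<Longrightarrow> lie_pres_gen K X R x \<in> S"
  shows "S = carrier (lie_pres K X R)"
proof (rule antisym[OF subspace_subset[OF subalg_subspace[OF S]]])
  let ?F = "free_lie K X" and ?pi = "\<lambda>p. alg_ideal_gen K (free_lie K X) R +>\<^bsub>free_lie K X\<^esub> p"
  have "{p \<in> carrier ?F. ?pi p \<in> S} = carrier ?F"
    using alg_hom_vimage_subalg[OF L.nonassoc_algebra_axioms P.nonassoc_algebra_axioms lie_pres_proj_hom S]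
    by (rule free_lie_subalg_eq) (simp add: free_lie_gen_carrier gens flip: lie_pres_gen_def)
  then show "carrier (lie_pres K X R) \<subseteq> S"
    unfolding lie_pres_def L.alg_quot_carrier[OF relators_ideal] by blast
qed

lemma lie_pres_hom_eqI:
  assumes B: "lie_algebra K B" and f: "f \<in> alg_hom K (lie_pres K X R) B" and g: "g \<in> alg_hom K (lie_pres K X R) B"
    and gens: "\<And>x. x \<in> X \<Longrightarrow> f (lie_pres_gen K X R x) = g (lie_pres_gen K X R x)"
    and u: "u \<in> carrier (lie_pres K X R)"
  shows "f u = g u"
proof -
  interpret B: lie_algebra K B by (rule B)
  have "{u \<in> carrier (lie_pres K X R). f u = g u} = carrier (lie_pres K X R)"
    using alg_hom_equalizer_subalg[OF P.nonassoc_algebra_axioms B.nonassoc_algebra_axioms f g]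
    by (rule lie_pres_subalg_eq) (simp add: lie_pres_gen_carrier gens)
  then show ?thesis
    using u by blast
qed

end

end

end

section \<open>Free products of abelian Lie algebras\<close>

context vectorspace
begin

lemma basis_subspace_eq:
  assumes B: "basis B" and W: "VectorSpace.subspace K W V" and "B \<subseteq> W"
  shows "W = carrier V"
proof (rule antisym[OF subspace_subset[OF W]])
  have "span B \<subseteq> W"
    using assms is_module[OF W] by (intro span_is_subset) auto
  then show "carrier V \<subseteq> W"
    using B by (simp add: basis_def)
qed

lemma basis_linear_extension:
  assumes B: "basis B" and fin: "finite B" and W: "vectorspace K W" and g: "g \<in> B \<rightarrow> carrier W"
  shows "\<exists>f \<in> LinearCombinations.module_hom K V W. \<forall>b \<in> B. f b = g b"
proof -
  interpret W: vectorspace K W by (rule W)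
  have BV: "B \<subseteq> carrier V"
    using B by (simp add: basis_def)
  \<comment> \<open>A coefficient function is determined by \<open>v\<close> only on
    \<open>B\<close>; requiring it to be extensional fixes the other values, so that the description
    is unique.\<close>
  define crd where "crd v = (THE c. c \<in> B \<rightarrow>\<^sub>E carrier K \<and> lincomb c B = v)" for v
  have ex1: "\<exists>!c. c \<in> B \<rightarrow>\<^sub>E carrier K \<and> lincomb c B = v" if "v \<in> carrier V" for v
    using basis_criterion[OF fin BV] B that by blast
  have crd: "crd v \<in> B \<rightarrow>\<^sub>E carrier K" "lincomb (crd v) B = v" if "v \<in> carrier V" for v
    using theI'[OF ex1[OF that]] by (auto simp: crd_def)
  have crd_eq: "crd v b = c b" if "c \<in> B \<rightarrow> carrier K" "lincomb c B = v" "b \<in> B" for v c b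
  proof -
    have "lincomb (restrict c B) B = v"
      using that BV lincomb_cong[OF refl BV, of "restrict c B" c] by simp
    moreover have "restrict c B \<in> B \<rightarrow>\<^sub>E carrier K"
      using that by auto
    moreover have "v \<in> carrier V"
      using that BV by auto
    ultimately have "crd v = restrict c B"
      using ex1 crd by metis
    then show ?thesis
      using that by simp
  qed
  have crdK [simp]: "crd v b \<in> carrier K" if "v \<in> carrier V" "b \<in> B" for v b
    using crd(1)[OF that(1)] that(2) by (auto elim: PiE_mem)
  have gW [simp]: "g b \<in> carrier W" if "b \<in> B" for b
    using g that by auto
  define f where "f v = (\<Oplus>\<^bsub>W\<^esub>b\<in>B. crd v b \<odot>\<^bsub>W\<^esub> g b)" for v
  have "f \<in> LinearCombinations.module_hom K V W"
    unfolding LinearCombinations.module_hom_def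
  proof (intro CollectI conjI allI impI funcsetI)
    show "f v \<in> carrier W" if "v \<in> carrier V" for v
      unfolding f_def using that by (intro W.M.finsum_closed) auto
    fix v w assume vw: "v \<in> carrier V \<and> w \<in> carrier V"
    have "lincomb (\<lambda>b. crd v b \<oplus>\<^bsub>K\<^esub> crd w b) B = v \<oplus>\<^bsub>V\<^esub> w"
      using vw fin BV crd lincomb_sum[OF fin BV, of "crd v" "crd w"] by (auto simp: PiE_def)
    then have "crd (v \<oplus>\<^bsub>V\<^esub> w) b = crd v b \<oplus>\<^bsub>K\<^esub> crd w b" if "b \<in> B" for b
      using that vw by (intro crd_eq) auto
    then have "f (v \<oplus>\<^bsub>V\<^esub> w) = (\<Oplus>\<^bsub>W\<^esub>b\<in>B. crd v b \<odot>\<^bsub>W\<^esub> g b \<oplus>\<^bsub>W\<^esub> crd w b \<odot>\<^bsub>W\<^esub> g b)"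
      unfolding f_def using vw by (intro W.M.add.finprod_cong') (auto simp: W.smult_l_distr)
    also have "\<dots> = f v \<oplus>\<^bsub>W\<^esub> f w"
      unfolding f_def using vw by (intro W.M.finsum_addf) auto
    finally show "f (v \<oplus>\<^bsub>V\<^esub> w) = f v \<oplus>\<^bsub>W\<^esub> f w" .
  next
    fix c v assume cv: "c \<in> carrier K \<and> v \<in> carrier V"
    have "lincomb (\<lambda>b. c \<otimes>\<^bsub>K\<^esub> crd v b) B = c \<odot>\<^bsub>V\<^esub> v"
      using cv BV crd lincomb_smult[OF BV, of "crd v" c] by (auto simp: PiE_def)
    then have "crd (c \<odot>\<^bsub>V\<^esub> v) b = c \<otimes>\<^bsub>K\<^esub> crd v b" if "b \<in> B" for b
      using that cv by (intro crd_eq) auto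
    then have "f (c \<odot>\<^bsub>V\<^esub> v) = (\<Oplus>\<^bsub>W\<^esub>b\<in>B. c \<odot>\<^bsub>W\<^esub> (crd v b \<odot>\<^bsub>W\<^esub> g b))"
      unfolding f_def using cv by (intro W.M.add.finprod_cong') (auto simp: W.smult_assoc1)
    also have "\<dots> = c \<odot>\<^bsub>W\<^esub> f v"
      unfolding f_def using cv fin by (subst W.finsum_smult) auto
    finally show "f (c \<odot>\<^bsub>V\<^esub> v) = c \<odot>\<^bsub>W\<^esub> f v" .
  qed
  moreover have "f b = g b" if b: "b \<in> B" for b
  proof -
    let ?d = "\<lambda>b'. if b' = b then \<one>\<^bsub>K\<^esub> else \<zero>\<^bsub>K\<^esub>"
    have "lincomb ?d B = (\<Oplus>\<^bsub>V\<^esub>b'\<in>{b}. ?d b' \<odot>\<^bsub>V\<^esub> b')"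
      unfolding lincomb_def using b BV fin by (intro M.add.finprod_mono_neutral_cong_right) auto
    then have "lincomb ?d B = b"
      using b BV by auto
    then have "crd b b' = ?d b'" if "b' \<in> B" for b'
      using that by (intro crd_eq) auto
    then have "f b = (\<Oplus>\<^bsub>W\<^esub>b'\<in>{b}. ?d b' \<odot>\<^bsub>W\<^esub> g b')"
      unfolding f_def using b fin by (intro W.M.add.finprod_mono_neutral_cong_right) auto
    then show ?thesis
      using b by simp
  qed
  ultimately show ?thesis
    by blast
qed

end

text \<open>Since \<open>M\<close> is abelian, the linear extension \<open>f\<close> is
  multiplicative exactly if all products \<open>f u \<otimes> f v\<close> vanish. This is bilinear
  in \<open>u\<close> and \<open>v\<close>, so it spreads from the basis to each argument in
  turn.\<close>

lemma abelian_lie_hom_extension: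
  assumes M: "abelian_lie_algebra K M" and S: "vectorspace.basis K M S" and fin: "finite S"
    and B: "nonassoc_algebra K B" and g: "g \<in> S \<rightarrow> carrier B"
    and comm: "\<And>s s'. \<lbrakk>s \<in> S; s' \<in> S\<rbrakk> \<Longrightarrow> g s \<otimes>\<^bsub>B\<^esub> g s' = \<zero>\<^bsub>B\<^esub>"
  shows "\<exists>f \<in> alg_hom K M B. \<forall>s \<in> S. f s = g s"
proof -
  interpret M: lie_algebra K M
    using M by (simp add: abelian_lie_algebra_def)
  interpret B: nonassoc_algebra K B by (rule B)
  have SM: "S \<subseteq> carrier M"
    using S by (simp add: M.basis_def)
  obtain f where f: "f \<in> LinearCombinations.module_hom K M B" and fg: "\<And>s. s \<in> S \<Longrightarrow> f s = g s"
    using M.basis_linear_extension[OF S fin B.vectorspace_axioms g] by blast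
  interpret f: linear_map K M B f
    using f M.vectorspace_axioms B.vectorspace_axioms
    by (intro linear_map.intro mod_hom.intro mod_hom_axioms.intro) (auto simp: vectorspace.axioms)
  have left: "f u \<otimes>\<^bsub>B\<^esub> g s = \<zero>\<^bsub>B\<^esub>" if u: "u \<in> carrier M" and s: "s \<in> S" for u s
  proof -
    have "g s \<in> carrier B"
      using g s by auto
    then have "VectorSpace.subspace K {u \<in> carrier M. f u \<otimes>\<^bsub>B\<^esub> g s = \<zero>\<^bsub>B\<^esub>} M"
      by (intro subspaceI M.vectorspace_axioms) (auto simp: B.prod_add_left B.prod_smult_left)
    then have "{u \<in> carrier M. f u \<otimes>\<^bsub>B\<^esub> g s = \<zero>\<^bsub>B\<^esub>} = carrier M"
      using SM fg comm s by (intro M.basis_subspace_eq[OF S]) auto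
    then show ?thesis
      using u by blast
  qed
  have "f u \<otimes>\<^bsub>B\<^esub> f v = \<zero>\<^bsub>B\<^esub>" if u: "u \<in> carrier M" and v: "v \<in> carrier M" for u v
  proof -
    have "VectorSpace.subspace K {v \<in> carrier M. f u \<otimes>\<^bsub>B\<^esub> f v = \<zero>\<^bsub>B\<^esub>} M"
      using u by (intro subspaceI M.vectorspace_axioms) (auto simp: B.prod_add_right B.prod_smult_right)
    then have "{v \<in> carrier M. f u \<otimes>\<^bsub>B\<^esub> f v = \<zero>\<^bsub>B\<^esub>} = carrier M"
      using SM fg left u by (intro M.basis_subspace_eq[OF S]) auto
    then show ?thesis
      using v by blast
  qed
  then have "f \<in> alg_hom K M B"
    using M f by (auto simp: alg_hom_def abelian_lie_algebra_def)
  with fg show ?thesis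
    by blast
qed

lemma alg_hom_basis_eq:
  assumes A: "nonassoc_algebra K A" and B: "nonassoc_algebra K B" and S: "vectorspace.basis K A S"
    and f: "f \<in> alg_hom K A B" and g: "g \<in> alg_hom K A B" and eq: "\<And>s. s \<in> S \<Longrightarrow> f s = g s"
    and u: "u \<in> carrier A"
  shows "f u = g u"
proof -
  interpret A: nonassoc_algebra K A by (rule A)
  have "S \<subseteq> carrier A"
    using S by (simp add: A.basis_def)
  then have "{u \<in> carrier A. f u = g u} = carrier A"
    using eq subalg_subspace[OF alg_hom_equalizer_subalg[OF A B f g]]
    by (intro A.basis_subspace_eq[OF S]) auto
  then show ?thesis
    using u by blast
qed

section \<open>The universal property of the free product\<close>

lemma hom_relators_closed:
  assumes "nonassoc_algebra K M" and "nonassoc_algebra K F" and i: "i \<in> carrier M \<rightarrow> carrier F"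
  shows "hom_relators K M F i \<subseteq> carrier F"
proof -
  interpret M: nonassoc_algebra K M by fact
  interpret F: nonassoc_algebra K F by fact
  have [simp]: "i u \<in> carrier F" if "u \<in> carrier M" for u
    using that i by auto
  show ?thesis
    by (auto simp: hom_relators_def)
qed

context
  fixes K :: "('k, 'r) ring_scheme" and M :: "('k, 'a, 'm) module_scheme"
    and F :: "('k, 'c, 'n) module_scheme" and B :: "('k, 'b, 'o) module_scheme" and i and h
  assumes M: "nonassoc_algebra K M" and F: "nonassoc_algebra K F" and B: "nonassoc_algebra K B"
    and i: "i \<in> carrier M \<rightarrow> carrier F" and h: "h \<in> alg_hom K F B"
begin

interpretation M: nonassoc_algebra K M by (rule M)
interpretation F: nonassoc_algebra K F by (rule F)
interpretation B: nonassoc_algebra K B by (rule B)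

text \<open>Each relator is the difference of the two sides of one homomorphism law. From left to
  right, with \<open>h\<close> the projection, the inclusions into the free product become
  homomorphisms; from right to left, a pair of homomorphisms kills the relators and can be
  lifted.\<close>

lemma hom_relators_vanish_iff:
  "(\<forall>r \<in> hom_relators K M F i. h r = \<zero>\<^bsub>B\<^esub>) \<longleftrightarrow> (\<lambda>u. h (i u)) \<in> alg_hom K M B"
proof -
  have [simp]: "i u \<in> carrier F" if "u \<in> carrier M" for u
    using that i by auto
  note [simp] = alg_hom_simps[OF h]
  have vanish: "h (p \<ominus>\<^bsub>F\<^esub> q) = \<zero>\<^bsub>B\<^esub> \<longleftrightarrow> h p = h q" if "p \<in> carrier F" "q \<in> carrier F" for p q
    using that B.M.minus_eq_zero_imp_eq[of "h p" "h q"]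
    by (auto simp: alg_hom_minus[OF F.vectorspace_axioms B.vectorspace_axioms h] a_minus_def[of B] B.M.r_neg)
  have "(\<forall>r \<in> hom_relators K M F i. h r = \<zero>\<^bsub>B\<^esub>) \<longleftrightarrow>
      (\<forall>u \<in> carrier M. \<forall>v \<in> carrier M. h (i (u \<oplus>\<^bsub>M\<^esub> v)) = h (i u) \<oplus>\<^bsub>B\<^esub> h (i v)) \<and>
      (\<forall>c \<in> carrier K. \<forall>u \<in> carrier M. h (i (c \<odot>\<^bsub>M\<^esub> u)) = c \<odot>\<^bsub>B\<^esub> h (i u)) \<and>
      (\<forall>u \<in> carrier M. \<forall>v \<in> carrier M. h (i (u \<otimes>\<^bsub>M\<^esub> v)) = h (i u) \<otimes>\<^bsub>B\<^esub> h (i v))"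
    (is "_ \<longleftrightarrow> ?hom")
  proof
    assume rel: "\<forall>r \<in> hom_relators K M F i. h r = \<zero>\<^bsub>B\<^esub>"
    have "h (i (u \<oplus>\<^bsub>M\<^esub> v) \<ominus>\<^bsub>F\<^esub> (i u \<oplus>\<^bsub>F\<^esub> i v)) = \<zero>\<^bsub>B\<^esub>" if "u \<in> carrier M" "v \<in> carrier M" for u v
      by (rule rel[rule_format]) (unfold hom_relators_def, use that in blast)
    moreover have "h (i (c \<odot>\<^bsub>M\<^esub> u) \<ominus>\<^bsub>F\<^esub> (c \<odot>\<^bsub>F\<^esub> i u)) = \<zero>\<^bsub>B\<^esub>" if "c \<in> carrier K" "u \<in> carrier M" for c u
      by (rule rel[rule_format]) (unfold hom_relators_def, use that in blast)
    moreover have "h (i (u \<otimes>\<^bsub>M\<^esub> v) \<ominus>\<^bsub>F\<^esub> (i u \<otimes>\<^bsub>F\<^esub> i v)) = \<zero>\<^bsub>B\<^esub>" if "u \<in> carrier M" "v \<in> carrier M" for u v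
      by (rule rel[rule_format]) (unfold hom_relators_def, use that in blast)
    ultimately show ?hom
      by (simp add: vanish)
  next
    assume ?hom
    then show "\<forall>r \<in> hom_relators K M F i. h r = \<zero>\<^bsub>B\<^esub>"
      unfolding hom_relators_def by (auto simp: vanish)
  qed
  also have "\<dots> \<longleftrightarrow> (\<lambda>u. h (i u)) \<in> alg_hom K M B"
    by (auto simp: alg_hom_def LinearCombinations.module_hom_def)
  finally show ?thesis .
qed

end

context
  fixes K :: "('k, 'r) ring_scheme" and M :: "('k, 'a, 'm) module_scheme" and N :: "('k, 'b, 'n) module_scheme"
  assumes M: "lie_algebra K M" and N: "lie_algebra K N"
begin

interpretation M: lie_algebra K M by (rule M)
interpretation N: lie_algebra K N by (rule N)

abbreviation (input) "fp_letters \<equiv> free_prod_letters M N"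
abbreviation (input) "fp_free \<equiv> free_lie K (free_prod_letters M N)"
abbreviation (input) "fp_inl \<equiv> \<lambda>u. free_lie_gen K (free_prod_letters M N) (Inl u)"
abbreviation (input) "fp_inr \<equiv> \<lambda>v. free_lie_gen K (free_prod_letters M N) (Inr v)"

interpretation F: lie_algebra K fp_free
  by (rule lie_algebra_free_lie[OF M.field.field_axioms])

lemma fp_gens_closed: "fp_inl \<in> carrier M \<rightarrow> carrier fp_free" "fp_inr \<in> carrier N \<rightarrow> carrier fp_free"
  by (auto intro!: free_lie_gen_carrier[OF M.field.field_axioms] simp: free_prod_letters_def)

lemma free_prod_relators_eq:
  "free_prod_relators K M N = hom_relators K M fp_free fp_inl \<union> hom_relators K N fp_free fp_inr"
  by (simp add: free_prod_relators_def Let_def)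

lemma free_prod_relators_closed: "free_prod_relators K M N \<subseteq> carrier fp_free"
  unfolding free_prod_relators_eq
  by (intro Un_least hom_relators_closed fp_gens_closed F.nonassoc_algebra_axioms
      M.nonassoc_algebra_axioms N.nonassoc_algebra_axioms)

lemma lie_algebra_free_prod: "lie_algebra K (lie_free_prod K M N)"
  unfolding lie_free_prod_def
  by (rule lie_algebra_lie_pres[OF M.field.field_axioms free_prod_relators_closed])

interpretation L: lie_algebra K "lie_free_prod K M N" by (rule lie_algebra_free_prod)

lemma free_prod_proj_vanish:
  "r \<in> free_prod_relators K M N \<Longrightarrow>
    alg_ideal_gen K fp_free (free_prod_relators K M N) +>\<^bsub>fp_free\<^esub> r = \<zero>\<^bsub>lie_free_prod K M N\<^esub>"
  unfolding lie_free_prod_def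
  by (rule lie_pres_relator[OF M.field.field_axioms free_prod_relators_closed])

lemma free_prod_proj_hom:
  "(\<lambda>p. alg_ideal_gen K fp_free (free_prod_relators K M N) +>\<^bsub>fp_free\<^esub> p)
    \<in> alg_hom K fp_free (lie_free_prod K M N)"
  unfolding lie_free_prod_def
  by (rule lie_pres_proj_hom[OF M.field.field_axioms free_prod_relators_closed])

lemma free_prod_inl_hom: "free_prod_inl K M N \<in> alg_hom K M (lie_free_prod K M N)"
  unfolding free_prod_inl_def lie_pres_gen_def
  using free_prod_proj_vanish
  by (subst hom_relators_vanish_iff[OF M.nonassoc_algebra_axioms F.nonassoc_algebra_axioms
        L.nonassoc_algebra_axioms fp_gens_closed(1) free_prod_proj_hom, symmetric])
    (simp add: free_prod_relators_eq)

lemma free_prod_inr_hom: "free_prod_inr K M N \<in> alg_hom K N (lie_free_prod K M N)"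
  unfolding free_prod_inr_def lie_pres_gen_def
  using free_prod_proj_vanish
  by (subst hom_relators_vanish_iff[OF N.nonassoc_algebra_axioms F.nonassoc_algebra_axioms
        L.nonassoc_algebra_axioms fp_gens_closed(2) free_prod_proj_hom, symmetric])
    (simp add: free_prod_relators_eq)

lemma lie_free_prod_lift:
  assumes B: "lie_algebra K B" and f: "f \<in> alg_hom K M B" and g: "g \<in> alg_hom K N B"
  shows "\<exists>h \<in> alg_hom K (lie_free_prod K M N) B.
    (\<forall>u \<in> carrier M. h (free_prod_inl K M N u) = f u) \<and>
    (\<forall>v \<in> carrier N. h (free_prod_inr K M N v) = g v)"
proof -
  interpret B: lie_algebra K B by (rule B)
  let ?fg = "case_sum f g"
  have "\<exists>h \<in> alg_hom K (lie_pres K fp_letters (free_prod_relators K M N)) B.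
      \<forall>y \<in> fp_letters. h (lie_pres_gen K fp_letters (free_prod_relators K M N) y) = ?fg y"
  proof (rule lie_pres_lift[OF M.field.field_axioms free_prod_relators_closed B])
    show "?fg \<in> fp_letters \<rightarrow> carrier B"
      using alg_hom_closed[OF f] alg_hom_closed[OF g] by (auto simp: free_prod_letters_def)
    fix h r
    assume h: "h \<in> alg_hom K fp_free B"
      and hx: "\<And>y. y \<in> fp_letters \<Longrightarrow> h (free_lie_gen K fp_letters y) = ?fg y"
      and r: "r \<in> free_prod_relators K M N"
    \<comment> \<open>The composite agrees with \<open>f\<close> on \<open>carrier M\<close> only
      and need not be the same function, so its membership in \<open>alg_hom\<close> is derived
      afresh.\<close>
    have "h (fp_inl u) = f u" if "u \<in> carrier M" for u
      using that hx[of "Inl u"] by (simp add: free_prod_letters_def)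
    then have "(\<lambda>u. h (fp_inl u)) \<in> alg_hom K M B"
      by (intro alg_homI) (simp_all add: alg_hom_simps[OF f])
    moreover have "h (fp_inr v) = g v" if "v \<in> carrier N" for v
      using that hx[of "Inr v"] by (simp add: free_prod_letters_def)
    then have "(\<lambda>v. h (fp_inr v)) \<in> alg_hom K N B"
      by (intro alg_homI) (simp_all add: alg_hom_simps[OF g])
    ultimately show "h r = \<zero>\<^bsub>B\<^esub>"
      using r
        hom_relators_vanish_iff[OF M.nonassoc_algebra_axioms F.nonassoc_algebra_axioms
          B.nonassoc_algebra_axioms fp_gens_closed(1) h]
        hom_relators_vanish_iff[OF N.nonassoc_algebra_axioms F.nonassoc_algebra_axioms
          B.nonassoc_algebra_axioms fp_gens_closed(2) h]
      by (auto simp: free_prod_relators_eq)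
  qed
  then show ?thesis
    by (simp add: lie_free_prod_def free_prod_inl_def free_prod_inr_def free_prod_letters_def ball_Un)
qed

lemma lie_free_prod_hom_eqI:
  assumes B: "lie_algebra K B"
    and f: "f \<in> alg_hom K (lie_free_prod K M N) B" and g: "g \<in> alg_hom K (lie_free_prod K M N) B"
    and inl: "\<And>u. u \<in> carrier M \<Longrightarrow> f (free_prod_inl K M N u) = g (free_prod_inl K M N u)"
    and inr: "\<And>v. v \<in> carrier N \<Longrightarrow> f (free_prod_inr K M N v) = g (free_prod_inr K M N v)"
    and u: "u \<in> carrier (lie_free_prod K M N)"
  shows "f u = g u"
  using lie_pres_hom_eqI[OF M.field.field_axioms free_prod_relators_closed B,
      folded lie_free_prod_def, OF f g _ u] inl inr
  by (auto simp: free_prod_letters_def free_prod_inl_def free_prod_inr_def)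

end

text \<open>Each side has a universal property, which yields \<open>\<phi>\<close> and
  \<open>\<psi>\<close>. The composites fix the generators and are therefore identities. The passage
  between all elements of \<open>M\<close>, \<open>N\<close> as letters and only \<open>a\<close>,
  \<open>b\<close>, \<open>x\<close> goes through the bases.\<close>

lemma free_prod_presentation:
  fixes K :: "('k, 'r) ring_scheme"
    and M :: "('k, 'a, 'm) module_scheme" and N :: "('k, 'b, 'n) module_scheme"
    and a b :: 'a and x :: 'b
  defines "L \<equiv> lie_free_prod K M N"
    and "X \<equiv> {Inl a, Inl b, Inr x}"
  defines "R \<equiv> {free_lie_gen K X (Inl a) \<otimes>\<^bsub>free_lie K X\<^esub> free_lie_gen K X (Inl b)}"
  assumes M: "abelian_lie_algebra K M" and basisM: "vectorspace.basis K M {a, b}" and ab: "a \<noteq> b"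
    and N: "abelian_lie_algebra K N" and basisN: "vectorspace.basis K N {x}"
  shows "\<exists>\<phi> \<in> alg_iso K L (lie_pres K X R).
    \<phi> (free_prod_inl K M N a) = lie_pres_gen K X R (Inl a) \<and>
    \<phi> (free_prod_inl K M N b) = lie_pres_gen K X R (Inl b) \<and>
    \<phi> (free_prod_inr K M N x) = lie_pres_gen K X R (Inr x)"
proof -
  interpret M: lie_algebra K M
    using M by (simp add: abelian_lie_algebra_def)
  interpret N: lie_algebra K N
    using N by (simp add: abelian_lie_algebra_def)
  note field = M.field.field_axioms and MN = M.lie_algebra_axioms N.lie_algebra_axioms
  interpret L: lie_algebra K L
    unfolding L_def by (rule lie_algebra_free_prod[OF MN])
  interpret F: lie_algebra K "free_lie K X"
    by (rule lie_algebra_free_lie[OF field])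
  have X: "Inl a \<in> X" "Inl b \<in> X" "Inr x \<in> X"
    by (auto simp: X_def)
  have R: "R \<subseteq> carrier (free_lie K X)"
    using X by (simp add: R_def free_lie_gen_carrier[OF field])
  let ?P = "lie_pres K X R" and ?gen = "lie_pres_gen K X R"
  interpret P: lie_algebra K ?P
    by (rule lie_algebra_lie_pres[OF field R])
  have gen [simp]: "?gen y \<in> carrier ?P" if "y \<in> X" for y
    using that by (rule lie_pres_gen_carrier[OF field R])
  have abM: "a \<in> carrier M" "b \<in> carrier M" and xN: "x \<in> carrier N"
    using basisM basisN by (auto simp: M.basis_def N.basis_def)
  have comm: "?gen (Inl a) \<otimes>\<^bsub>?P\<^esub> ?gen (Inl b) = \<zero>\<^bsub>?P\<^esub>"
    by (rule lie_pres_gen_bracket[OF field R]) (simp_all add: X R_def)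
  \<comment> \<open>\<open>abelian_lie_hom_extension\<close> asks for both orders of a pair, whereas
    \<open>R\<close> contains only one of them.\<close>
  then have comm': "?gen (Inl b) \<otimes>\<^bsub>?P\<^esub> ?gen (Inl a) = \<zero>\<^bsub>?P\<^esub>"
    using P.bracket_anticomm[of "?gen (Inl b)" "?gen (Inl a)"] X by simp
  have "\<exists>i \<in> alg_hom K M ?P. \<forall>u \<in> {a, b}. i u = ?gen (Inl u)"
    by (rule abelian_lie_hom_extension[OF M basisM _ P.nonassoc_algebra_axioms])
      (use X comm comm' P.bracket_self in auto)
  then obtain i where i: "i \<in> alg_hom K M ?P" and iab: "i a = ?gen (Inl a)" "i b = ?gen (Inl b)"
    by auto
  have "\<exists>j \<in> alg_hom K N ?P. \<forall>v \<in> {x}. j v = ?gen (Inr v)"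
    by (rule abelian_lie_hom_extension[OF N basisN _ P.nonassoc_algebra_axioms])
      (use X P.bracket_self in auto)
  then obtain j where j: "j \<in> alg_hom K N ?P" and jx: "j x = ?gen (Inr x)"
    by auto
  obtain \<phi> where \<phi>: "\<phi> \<in> alg_hom K L ?P"
    and \<phi>_inl: "\<And>u. u \<in> carrier M \<Longrightarrow> \<phi> (free_prod_inl K M N u) = i u"
    and \<phi>_inr: "\<And>v. v \<in> carrier N \<Longrightarrow> \<phi> (free_prod_inr K M N v) = j v"
    using lie_free_prod_lift[OF MN P.lie_algebra_axioms i j] unfolding L_def by blast
  note inl = free_prod_inl_hom[OF MN, folded L_def] and inr = free_prod_inr_hom[OF MN, folded L_def]
  define f where "f = case_sum (free_prod_inl K M N) (free_prod_inr K M N)"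
  have "\<exists>h \<in> alg_hom K ?P L. \<forall>y \<in> X. h (?gen y) = f y"
  proof (rule lie_pres_lift[OF field R L.lie_algebra_axioms])
    show "f \<in> X \<rightarrow> carrier L"
      using alg_hom_closed[OF inl] alg_hom_closed[OF inr] abM xN by (auto simp: X_def f_def)
    fix h r
    assume h: "h \<in> alg_hom K (free_lie K X) L" and hX: "\<And>y. y \<in> X \<Longrightarrow> h (free_lie_gen K X y) = f y"
      and r: "r \<in> R"
    have "h r = f (Inl a) \<otimes>\<^bsub>L\<^esub> f (Inl b)"
      using r hX X by (simp add: R_def alg_hom_prod[OF h] free_lie_gen_carrier[OF field])
    also have "\<dots> = free_prod_inl K M N (a \<otimes>\<^bsub>M\<^esub> b)"
      using abM by (simp add: f_def alg_hom_prod[OF inl])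
    also have "\<dots> = \<zero>\<^bsub>L\<^esub>"
      using M abM alg_hom_zero[OF M.vectorspace_axioms L.vectorspace_axioms inl]
      by (simp add: abelian_lie_algebra_def)
    finally show "h r = \<zero>\<^bsub>L\<^esub>" .
  qed
  then obtain \<psi> where \<psi>: "\<psi> \<in> alg_hom K ?P L" and \<psi>_gen: "\<And>y. y \<in> X \<Longrightarrow> \<psi> (?gen y) = f y"
    by blast
  have "(\<phi> \<circ> \<psi>) p = id p" if "p \<in> carrier ?P" for p
  proof (rule lie_pres_hom_eqI[OF field R P.lie_algebra_axioms alg_hom_comp[OF \<psi> \<phi>] _ _ that])
    show "id \<in> alg_hom K ?P ?P"
      by (rule alg_homI) auto
    show "(\<phi> \<circ> \<psi>) (?gen y) = id (?gen y)" if "y \<in> X" for y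
    proof -
      have "y = Inl a \<or> y = Inl b \<or> y = Inr x"
        using that by (simp add: X_def)
      then show ?thesis
        using X abM xN by (auto simp: \<psi>_gen f_def \<phi>_inl \<phi>_inr iab jx)
    qed
  qed
  moreover have "(\<psi> \<circ> \<phi>) u = id u" if "u \<in> carrier L" for u
  proof (rule lie_free_prod_hom_eqI[OF MN L.lie_algebra_axioms _ _ _ _ that[unfolded L_def], folded L_def])
    show "\<psi> \<circ> \<phi> \<in> alg_hom K L L"
      by (rule alg_hom_comp[OF \<phi> \<psi>])
    show "id \<in> alg_hom K L L"
      by (rule alg_homI) auto
    \<comment> \<open>The letters of the free product include every element of \<open>M\<close>;
      agreement on the basis is extended to them by linearity.\<close>
    have "(\<psi> \<circ> i) s = free_prod_inl K M N s" if "s \<in> {a, b}" for s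
      using that X by (elim insertE emptyE) (simp_all add: iab \<psi>_gen f_def)
    then have "(\<psi> \<circ> i) u = free_prod_inl K M N u" if "u \<in> carrier M" for u
      using that by (rule alg_hom_basis_eq[OF M.nonassoc_algebra_axioms L.nonassoc_algebra_axioms
            basisM alg_hom_comp[OF i \<psi>] inl])
    then show "(\<psi> \<circ> \<phi>) (free_prod_inl K M N u) = id (free_prod_inl K M N u)" if "u \<in> carrier M" for u
      using that by (simp add: \<phi>_inl)
    have "(\<psi> \<circ> j) s = free_prod_inr K M N s" if "s \<in> {x}" for s
      using that X by (elim insertE emptyE) (simp_all add: jx \<psi>_gen f_def)
    then have "(\<psi> \<circ> j) v = free_prod_inr K M N v" if "v \<in> carrier N" for v
      using that by (rule alg_hom_basis_eq[OF N.nonassoc_algebra_axioms L.nonassoc_algebra_axioms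
            basisN alg_hom_comp[OF j \<psi>] inr])
    then show "(\<psi> \<circ> \<phi>) (free_prod_inr K M N v) = id (free_prod_inr K M N v)" if "v \<in> carrier N" for v
      using that by (simp add: \<phi>_inr)
  qed
  ultimately have "bij_betw \<phi> (carrier L) (carrier ?P)"
    by (intro bij_betwI[where g = \<psi>] funcsetI alg_hom_closed[OF \<phi>] alg_hom_closed[OF \<psi>]) simp_all
  then have "\<phi> \<in> alg_iso K L ?P"
    using \<phi> by (simp add: alg_iso_iff)
  then show ?thesis
    by (rule bexI[rotated]) (simp add: abM xN iab jx \<phi>_inl \<phi>_inr)
qed

section \<open>A test Lie algebra\<close>

text \<open>
  A finite-dimensional stand-in for the part of the free product of degree at most 2 in \<open>a\<close>
  and \<open>b\<close>: the derivation \<open>CX\<close> sends \<open>CA0\<close> to \<open>CA1\<close> to \<open>CA2\<close> to 0, likewise for \<open>CB0\<close>, and the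
  central coordinates \<open>CC1\<close>, \<open>CC2\<close>, \<open>CC3\<close> are alternating forms invariant under this derivation.
  Invariance forces the \<open>A0 B2\<close> and \<open>A2 B0\<close> terms that accompany \<open>A1 B1\<close> in \<open>CC3\<close>, and none of the
  forms has an \<open>A0 B0\<close> term, so that \<open>CA0\<close> and \<open>CB0\<close> commute.
\<close>

datatype coord = CX | CA0 | CA1 | CA2 | CB0 | CB1 | CB2 | CC1 | CC2 | CC3

fun test_bracket :: "('k, 'r) ring_scheme \<Rightarrow> (coord \<Rightarrow> 'k) \<Rightarrow> (coord \<Rightarrow> 'k) \<Rightarrow> coord \<Rightarrow> 'k" where
  "test_bracket K f g CA1 = f CX \<otimes>\<^bsub>K\<^esub> g CA0 \<ominus>\<^bsub>K\<^esub> g CX \<otimes>\<^bsub>K\<^esub> f CA0"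
| "test_bracket K f g CA2 = f CX \<otimes>\<^bsub>K\<^esub> g CA1 \<ominus>\<^bsub>K\<^esub> g CX \<otimes>\<^bsub>K\<^esub> f CA1"
| "test_bracket K f g CB1 = f CX \<otimes>\<^bsub>K\<^esub> g CB0 \<ominus>\<^bsub>K\<^esub> g CX \<otimes>\<^bsub>K\<^esub> f CB0"
| "test_bracket K f g CB2 = f CX \<otimes>\<^bsub>K\<^esub> g CB1 \<ominus>\<^bsub>K\<^esub> g CX \<otimes>\<^bsub>K\<^esub> f CB1"
| "test_bracket K f g CC1 = f CA0 \<otimes>\<^bsub>K\<^esub> g CA1 \<ominus>\<^bsub>K\<^esub> f CA1 \<otimes>\<^bsub>K\<^esub> g CA0"
| "test_bracket K f g CC2 = (f CA0 \<otimes>\<^bsub>K\<^esub> g CB1 \<ominus>\<^bsub>K\<^esub> f CB1 \<otimes>\<^bsub>K\<^esub> g CA0) \<oplus>\<^bsub>K\<^esub>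
     (f CB0 \<otimes>\<^bsub>K\<^esub> g CA1 \<ominus>\<^bsub>K\<^esub> f CA1 \<otimes>\<^bsub>K\<^esub> g CB0)"
| "test_bracket K f g CC3 = (f CA1 \<otimes>\<^bsub>K\<^esub> g CB1 \<ominus>\<^bsub>K\<^esub> f CB1 \<otimes>\<^bsub>K\<^esub> g CA1) \<oplus>\<^bsub>K\<^esub>
     ((f CB2 \<otimes>\<^bsub>K\<^esub> g CA0 \<ominus>\<^bsub>K\<^esub> f CA0 \<otimes>\<^bsub>K\<^esub> g CB2) \<oplus>\<^bsub>K\<^esub>
      (f CB0 \<otimes>\<^bsub>K\<^esub> g CA2 \<ominus>\<^bsub>K\<^esub> f CA2 \<otimes>\<^bsub>K\<^esub> g CB0))"
| "test_bracket K f g _ = \<zero>\<^bsub>K\<^esub>"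

definition test_algebra :: "('k, 'r) ring_scheme \<Rightarrow> ('k, coord \<Rightarrow> 'k) module" where
  "test_algebra K =
    \<lparr>carrier = {f. \<forall>i. f i \<in> carrier K}, mult = test_bracket K, one = (\<lambda>i. \<zero>\<^bsub>K\<^esub>),
     zero = (\<lambda>i. \<zero>\<^bsub>K\<^esub>), add = (\<lambda>f g i. f i \<oplus>\<^bsub>K\<^esub> g i), smult = (\<lambda>c f i. c \<otimes>\<^bsub>K\<^esub> f i)\<rparr>"

lemma test_algebra_simps [simp]:
  "f \<in> carrier (test_algebra K) \<longleftrightarrow> (\<forall>i. f i \<in> carrier K)"
  "\<zero>\<^bsub>test_algebra K\<^esub> = (\<lambda>i. \<zero>\<^bsub>K\<^esub>)"
  "f \<oplus>\<^bsub>test_algebra K\<^esub> g = (\<lambda>i. f i \<oplus>\<^bsub>K\<^esub> g i)"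
  "c \<odot>\<^bsub>test_algebra K\<^esub> f = (\<lambda>i. c \<otimes>\<^bsub>K\<^esub> f i)"
  "f \<otimes>\<^bsub>test_algebra K\<^esub> g = test_bracket K f g"
  by (simp_all add: test_algebra_def)

context field
begin

lemma test_bracket_closed:
  assumes [simp]: "\<And>i. f i \<in> carrier R" "\<And>i. g i \<in> carrier R"
  shows "test_bracket R f g i \<in> carrier R"
  by (cases i) simp_all

lemma test_bracket_self:
  assumes [simp]: "\<And>i. f i \<in> carrier R"
  shows "test_bracket R f f i = \<zero>"
  by (cases i) (simp_all add: a_minus_def m_comm r_neg)

lemma test_bracket_add_left:
  assumes [simp]: "\<And>i. f i \<in> carrier R" "\<And>i. g i \<in> carrier R" "\<And>i. h i \<in> carrier R"
  shows "test_bracket R (\<lambda>i. f i \<oplus> g i) h i = test_bracket R f h i \<oplus> test_bracket R g h i"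
  by (cases i) (simp_all add: a_minus_def l_distr r_distr minus_add a_ac)

lemma test_bracket_smult_left:
  assumes [simp]: "c \<in> carrier R" "\<And>i. f i \<in> carrier R" "\<And>i. g i \<in> carrier R"
  shows "test_bracket R (\<lambda>i. c \<otimes> f i) g i = c \<otimes> test_bracket R f g i"
  by (cases i) (simp_all add: a_minus_def r_distr r_minus m_ac)

text \<open>Reduces linearity in the second argument to linearity in the first.\<close>

lemma test_bracket_anticomm:
  assumes [simp]: "\<And>i. f i \<in> carrier R" "\<And>i. g i \<in> carrier R"
  shows "test_bracket R f g i = \<ominus> test_bracket R g f i"
  by (cases i) (simp_all add: a_minus_def minus_add a_ac m_ac)

text \<open>The telescoping pattern of the Jacobi sum, in the two orders in which its three terms
  arise.\<close>

lemma minus_cycle: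
  assumes "u \<in> carrier R" and "v \<in> carrier R" and "w \<in> carrier R"
  shows "(u \<ominus> v) \<oplus> (v \<ominus> w) \<oplus> (w \<ominus> u) = \<zero>" and "(u \<ominus> v) \<oplus> (w \<ominus> u) \<oplus> (v \<ominus> w) = \<zero>"
proof -
  show "(u \<ominus> v) \<oplus> (v \<ominus> w) \<oplus> (w \<ominus> u) = \<zero>"
    using assms by (simp add: minus_add_minus)
  then show "(u \<ominus> v) \<oplus> (w \<ominus> u) \<oplus> (v \<ominus> w) = \<zero>"
    using assms by (simp add: a_ac)
qed

text \<open>
  The Jacobi identity reduces to the symmetry in \<open>f\<close> and \<open>h\<close> of the form multiplied by \<open>g CX\<close>.
\<close>

lemma test_bracket_jacobi:
  assumes [simp]: "\<And>i. f i \<in> carrier R" "\<And>i. g i \<in> carrier R" "\<And>i. h i \<in> carrier R"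
  shows "test_bracket R f (test_bracket R g h) i \<oplus> test_bracket R g (test_bracket R h f) i \<oplus>
    test_bracket R h (test_bracket R f g) i = \<zero>"
proof -
  \<comment> \<open>\<open>Q f h\<close> is the alternating form of coordinate \<open>i\<close>
    evaluated at \<open>f\<close> and the shifted \<open>h\<close>, where the shift moves
    \<open>CA0\<close> to \<open>CA1\<close> to \<open>CA2\<close> and likewise for
    \<open>CB0\<close>. Symmetry of \<open>Q\<close> is invariance of the form under the shift. For
    non-central \<open>i\<close> other than \<open>CA2\<close> and \<open>CB2\<close> a double
    bracket is zero, hence the default.\<close>
  define Q where "Q f h = (case i of
      CC1 \<Rightarrow> f CA0 \<otimes> h CA0
    | CC2 \<Rightarrow> f CA0 \<otimes> h CB0 \<oplus> f CB0 \<otimes> h CA0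
    | CC3 \<Rightarrow> (f CA1 \<otimes> h CB0 \<oplus> f CB0 \<otimes> h CA1) \<ominus> (f CB1 \<otimes> h CA0 \<oplus> f CA0 \<otimes> h CB1)
    | _ \<Rightarrow> \<zero>)" for f h :: "coord \<Rightarrow> 'a"
  have Q_closed: "Q f h \<in> carrier R" if "\<And>i. f i \<in> carrier R" "\<And>i. h i \<in> carrier R" for f h
    using that by (simp add: Q_def split: coord.split)
  have Q_sym: "Q f h = Q h f" if [simp]: "\<And>i. f i \<in> carrier R" "\<And>i. h i \<in> carrier R" for f h
    by (cases i) (simp_all add: Q_def a_minus_def minus_add a_ac m_ac)
  have nested: "test_bracket R f (test_bracket R g h) i = g CX \<otimes> Q f h \<ominus> h CX \<otimes> Q f g"
    if [simp]: "\<And>i. f i \<in> carrier R" "\<And>i. g i \<in> carrier R" "\<And>i. h i \<in> carrier R"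
      and "i \<notin> {CA2, CB2}" for f g h
    using that(4)
    by (cases i) (simp_all add: Q_def a_minus_def l_distr r_distr minus_add l_minus r_minus a_ac m_ac)
  show ?thesis
  proof (cases "i \<in> {CA2, CB2}")
    case False
    have "g CX \<otimes> Q f h \<ominus> h CX \<otimes> Q f g \<oplus> (h CX \<otimes> Q f g \<ominus> f CX \<otimes> Q g h) \<oplus>
        (f CX \<otimes> Q g h \<ominus> g CX \<otimes> Q f h) = \<zero>"
      by (rule minus_cycle) (simp_all add: Q_closed)
    then show ?thesis
      using False by (simp add: nested Q_sym[of g f] Q_sym[of h f] Q_sym[of h g])
  next
    case True
    \<comment> \<open>Only \<open>CA2\<close> and \<open>CB2\<close> see two successive shifts.
      There a double bracket is a difference of products of two \<open>CX\<close> coordinates and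
      one \<open>CA0\<close> or \<open>CB0\<close> coordinate, and each product occurs with both
      signs in the cyclic sum.\<close>
    have lin: "f CX \<otimes> (g CX \<otimes> p \<ominus> h CX \<otimes> q) = f CX \<otimes> g CX \<otimes> p \<ominus> h CX \<otimes> f CX \<otimes> q"
      if [simp]: "\<And>i. f i \<in> carrier R" "\<And>i. g i \<in> carrier R" "\<And>i. h i \<in> carrier R"
        "p \<in> carrier R" "q \<in> carrier R" for f g h :: "coord \<Rightarrow> 'a" and p q
      by (simp add: a_minus_def r_distr r_minus m_ac)
    show ?thesis
      using True minus_cycle(2)[of "f CX \<otimes> g CX \<otimes> h CA0" "h CX \<otimes> f CX \<otimes> g CA0" "g CX \<otimes> h CX \<otimes> f CA0"]
        minus_cycle(2)[of "f CX \<otimes> g CX \<otimes> h CB0" "h CX \<otimes> f CX \<otimes> g CB0" "g CX \<otimes> h CX \<otimes> f CB0"]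
      by (auto simp: lin minus_zero_right)
  qed
qed

lemma lie_algebra_test: "lie_algebra R (test_algebra R)"
proof (rule lie_algebraI)
  let ?T = "test_algebra R"
  have "vectorspace R ?T"
  proof (rule vs_criteria)
    show "\<forall>f\<in>carrier ?T. \<exists>g\<in>carrier ?T. f \<oplus>\<^bsub>?T\<^esub> g = \<zero>\<^bsub>?T\<^esub>"
    proof
      fix f assume "f \<in> carrier ?T"
      then show "\<exists>g\<in>carrier ?T. f \<oplus>\<^bsub>?T\<^esub> g = \<zero>\<^bsub>?T\<^esub>"
        by (intro bexI[of _ "\<lambda>i. \<ominus> f i"]) (simp_all add: r_neg)
    qed
  qed (auto simp: a_ac m_assoc l_distr r_distr field_axioms)
  moreover have "test_bracket R h (\<lambda>i. f i \<oplus> g i) i = test_bracket R h f i \<oplus> test_bracket R h g i"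
    if "\<And>i. f i \<in> carrier R" "\<And>i. g i \<in> carrier R" "\<And>i. h i \<in> carrier R" for f g h i
    using that by (simp add: test_bracket_anticomm[of h] test_bracket_add_left test_bracket_closed minus_add)
  moreover have "test_bracket R g (\<lambda>i. c \<otimes> f i) i = c \<otimes> test_bracket R g f i"
    if "c \<in> carrier R" "\<And>i. f i \<in> carrier R" "\<And>i. g i \<in> carrier R" for c f g i
    using that by (simp add: test_bracket_anticomm[of g] test_bracket_smult_left test_bracket_closed r_minus)
  ultimately show "nonassoc_algebra R ?T"
    by (intro nonassoc_algebra.intro nonassoc_algebra_axioms.intro)
      (simp_all add: fun_eq_iff test_bracket_closed test_bracket_add_left test_bracket_smult_left)
qed (simp_all add: fun_eq_iff test_bracket_self test_bracket_jacobi)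

text \<open>The letters are the coordinates of two vectors along \<open>a\<close>, \<open>b\<close>,
  \<open>z\<close>, \<open>t\<close>. Write \<open>p_ij\<close> for their minors. The Pluecker
  relation \<open>p_ab p_cd - p_ac p_bd + p_ad p_bc = 0\<close> with \<open>p_ac = p_cd = 0\<close>
  and \<open>p_ad = - p_bc\<close> leaves \<open>p_bc\<close> with square zero, and a field has no
  nilpotents.\<close>

lemma pluecker_vanish:
  assumes carr [simp]: "a \<in> carrier R" "b \<in> carrier R" "c \<in> carrier R" "d \<in> carrier R"
      "a' \<in> carrier R" "b' \<in> carrier R" "c' \<in> carrier R" "d' \<in> carrier R"
    and ac: "a \<otimes> c' \<ominus> c \<otimes> a' = \<zero>"
    and cd: "c \<otimes> d' \<ominus> d \<otimes> c' = \<zero>"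
    and ad: "(a \<otimes> d' \<ominus> d \<otimes> a') \<oplus> (b \<otimes> c' \<ominus> c \<otimes> b') = \<zero>"
  shows "c \<otimes> b' \<ominus> b \<otimes> c' = \<zero>"
proof -
  let ?q = "c \<otimes> b' \<ominus> b \<otimes> c'"
  have ac': "a \<otimes> c' = c \<otimes> a'" and cd': "c \<otimes> d' = d \<otimes> c'"
    by (rule minus_eq_zero_imp_eq[OF ac] minus_eq_zero_imp_eq[OF cd]; simp)+
  have "\<ominus> (b \<otimes> c' \<ominus> c \<otimes> b') = a \<otimes> d' \<ominus> d \<otimes> a'"
    using ad by (intro minus_equality) simp_all
  then have q: "a \<otimes> d' \<ominus> d \<otimes> a' = ?q"
    by (simp add: a_minus_def minus_add a_comm)
  have "(a \<otimes> d') \<otimes> (c \<otimes> b') = (a \<otimes> b') \<otimes> (c \<otimes> d')"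
    by (simp add: m_ac)
  also have "\<dots> = (d \<otimes> b') \<otimes> (a \<otimes> c')"
    unfolding cd' by (simp add: m_ac)
  also have "\<dots> = (d \<otimes> a') \<otimes> (c \<otimes> b')"
    unfolding ac' by (simp add: m_ac)
  finally have cb: "(a \<otimes> d') \<otimes> (c \<otimes> b') = (d \<otimes> a') \<otimes> (c \<otimes> b')" .
  have "(a \<otimes> d') \<otimes> (b \<otimes> c') = (b \<otimes> d') \<otimes> (a \<otimes> c')"
    by (simp add: m_ac)
  also have "\<dots> = (b \<otimes> a') \<otimes> (c \<otimes> d')"
    unfolding ac' by (simp add: m_ac)
  also have "\<dots> = (d \<otimes> a') \<otimes> (b \<otimes> c')"
    unfolding cd' by (simp add: m_ac)
  finally have bc: "(a \<otimes> d') \<otimes> (b \<otimes> c') = (d \<otimes> a') \<otimes> (b \<otimes> c')" .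
  have distr: "u \<otimes> ?q = u \<otimes> (c \<otimes> b') \<ominus> u \<otimes> (b \<otimes> c')" if "u \<in> carrier R" for u
    using that by (simp add: a_minus_def r_distr r_minus)
  \<comment> \<open>One factor is traded for the minor of \<open>a\<close> and \<open>d\<close>; by
    \<open>cb\<close> and \<open>bc\<close> its two products have the same multiple of
    \<open>?q\<close>, so the difference cancels.\<close>
  have "?q \<otimes> ?q = (a \<otimes> d' \<ominus> d \<otimes> a') \<otimes> ?q"
    by (simp only: q)
  also have "\<dots> = (a \<otimes> d') \<otimes> ?q \<ominus> (d \<otimes> a') \<otimes> ?q"
    by (simp add: a_minus_def[of R "a \<otimes> d'"] a_minus_def[of R "a \<otimes> d' \<otimes> ?q"] l_distr l_minus)
  also have "\<dots> = \<zero>"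
    using distr[of "a \<otimes> d'"] distr[of "d \<otimes> a'"] cb bc by (simp add: a_minus_def r_neg)
  finally show ?thesis
    by (simp add: integral_iff)
qed

end

section \<open>Commuting pairs\<close>

context nonassoc_algebra
begin

lemma subalg_nonassoc_algebra:
  assumes T: "subalg K T A"
  shows "nonassoc_algebra K (A\<lparr>carrier := T\<rparr>)"
proof -
  have "vectorspace K (A\<lparr>carrier := T\<rparr>)"
    by (rule subspace_is_vs[OF subalg_subspace[OF T]])
  then show ?thesis
    using subspace_subset[OF subalg_subspace[OF T]] subalg_prod[OF T]
    by (intro nonassoc_algebra.intro nonassoc_algebra_axioms.intro)
      (auto simp: prod_add_left prod_add_right prod_smult_left prod_smult_right subset_iff)
qed

end

lemma alg_iso_inv:
  assumes A: "nonassoc_algebra K A" and f: "f \<in> alg_iso K A B"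
  shows "inv_into (carrier A) f \<in> alg_hom K B A"
proof -
  interpret A: nonassoc_algebra K A by (rule A)
  have hom: "f \<in> alg_hom K A B" and bij: "bij_betw f (carrier A) (carrier B)"
    using f by (simp_all add: alg_iso_iff)
  let ?g = "inv_into (carrier A) f"
  have g [simp]: "?g y \<in> carrier A" "f (?g y) = y" if "y \<in> carrier B" for y
    using that bij by (auto simp: bij_betw_def inv_into_into f_inv_into_f)
  have eq: "?g y = u" if "u \<in> carrier A" "f u = y" for u y
    using that bij by (auto simp: bij_betw_def)
  show ?thesis
    by (rule alg_homI) (auto intro!: eq simp: alg_hom_simps[OF hom])
qed

lemma raa_relators_closed:
  assumes "field K" and "wf_digraph \<Gamma>"
  shows "{free_lie_gen K (verts \<Gamma>) u \<otimes>\<^bsub>free_lie K (verts \<Gamma>)\<^esub> free_lie_gen K (verts \<Gamma>) v | u v.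
    u \<rightarrow>\<^bsub>\<Gamma>\<^esub> v} \<subseteq> carrier (free_lie K (verts \<Gamma>))"
proof -
  interpret lie_algebra K "free_lie K (verts \<Gamma>)"
    by (rule lie_algebra_free_lie[OF assms(1)])
  show ?thesis
    using wf_digraph.adj_in_verts[OF assms(2)] by (auto intro!: free_lie_gen_carrier[OF assms(1)])
qed

text \<open>
  Sending each vertex \<open>v\<close> to \<open>\<alpha> v CX + \<beta> v CA0\<close> respects the edges, and it extends to a homomorphism
  whose \<open>CX\<close> and \<open>CA0\<close> coordinates are \<open>\<alpha>\<close> and \<open>\<beta>\<close>; the \<open>CA1\<close> coordinate of a bracket is then the minor.
\<close>

lemma raa_lie_minor_sum:
  fixes K :: "('k, 'r) ring_scheme"
    and \<alpha> \<beta> :: "('v magma \<Rightarrow> 'k) set set \<Rightarrow> 'k" and \<Gamma> :: "('v, 'e) pre_digraph"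
  defines "G \<equiv> raa_lie K \<Gamma>"
  assumes K: "field K" and \<Gamma>: "wf_digraph \<Gamma>"
    and closed: "\<And>u. u \<in> carrier G \<Longrightarrow> \<alpha> u \<in> carrier K" "\<And>u. u \<in> carrier G \<Longrightarrow> \<beta> u \<in> carrier K"
    and add: "\<And>u v. \<lbrakk>u \<in> carrier G; v \<in> carrier G\<rbrakk> \<Longrightarrow> \<alpha> (u \<oplus>\<^bsub>G\<^esub> v) = \<alpha> u \<oplus>\<^bsub>K\<^esub> \<alpha> v"
      "\<And>u v. \<lbrakk>u \<in> carrier G; v \<in> carrier G\<rbrakk> \<Longrightarrow> \<beta> (u \<oplus>\<^bsub>G\<^esub> v) = \<beta> u \<oplus>\<^bsub>K\<^esub> \<beta> v"
    and smult: "\<And>c u. \<lbrakk>c \<in> carrier K; u \<in> carrier G\<rbrakk> \<Longrightarrow> \<alpha> (c \<odot>\<^bsub>G\<^esub> u) = c \<otimes>\<^bsub>K\<^esub> \<alpha> u"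
      "\<And>c u. \<lbrakk>c \<in> carrier K; u \<in> carrier G\<rbrakk> \<Longrightarrow> \<beta> (c \<odot>\<^bsub>G\<^esub> u) = c \<otimes>\<^bsub>K\<^esub> \<beta> u"
    and bracket: "\<And>u v. \<lbrakk>u \<in> carrier G; v \<in> carrier G\<rbrakk> \<Longrightarrow> \<alpha> (u \<otimes>\<^bsub>G\<^esub> v) = \<zero>\<^bsub>K\<^esub>"
      "\<And>u v. \<lbrakk>u \<in> carrier G; v \<in> carrier G\<rbrakk> \<Longrightarrow> \<beta> (u \<otimes>\<^bsub>G\<^esub> v) = \<zero>\<^bsub>K\<^esub>"
    and minor: "\<And>u v. \<lbrakk>u \<in> carrier G; v \<in> carrier G; u \<otimes>\<^bsub>G\<^esub> v = \<zero>\<^bsub>G\<^esub>\<rbrakk> \<Longrightarrow>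
      \<alpha> u \<otimes>\<^bsub>K\<^esub> \<beta> v \<ominus>\<^bsub>K\<^esub> \<alpha> v \<otimes>\<^bsub>K\<^esub> \<beta> u = \<zero>\<^bsub>K\<^esub>"
    and mem: "u \<in> carrier G" "v \<in> carrier G" "u' \<in> carrier G" "v' \<in> carrier G"
    and sum: "u \<otimes>\<^bsub>G\<^esub> v \<oplus>\<^bsub>G\<^esub> u' \<otimes>\<^bsub>G\<^esub> v' = \<zero>\<^bsub>G\<^esub>"
  shows "(\<alpha> u \<otimes>\<^bsub>K\<^esub> \<beta> v \<ominus>\<^bsub>K\<^esub> \<alpha> v \<otimes>\<^bsub>K\<^esub> \<beta> u) \<oplus>\<^bsub>K\<^esub> (\<alpha> u' \<otimes>\<^bsub>K\<^esub> \<beta> v' \<ominus>\<^bsub>K\<^esub> \<alpha> v' \<otimes>\<^bsub>K\<^esub> \<beta> u') = \<zero>\<^bsub>K\<^esub>"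
proof -
  interpret K: field K by (rule K)
  interpret wf_digraph \<Gamma> by (rule \<Gamma>)
  interpret H: lie_algebra K "test_algebra K" by (rule K.lie_algebra_test)
  let ?X = "verts \<Gamma>" and ?H = "test_algebra K"
  let ?F = "free_lie K ?X"
  define R where "R = {free_lie_gen K ?X u \<otimes>\<^bsub>?F\<^esub> free_lie_gen K ?X v | u v. u \<rightarrow>\<^bsub>\<Gamma>\<^esub> v}"
  have G_eq: "G = lie_pres K ?X R"
    by (simp add: G_def raa_lie_def R_def)
  interpret F: lie_algebra K ?F by (rule lie_algebra_free_lie[OF K])
  have R: "R \<subseteq> carrier ?F"
    unfolding R_def by (rule raa_relators_closed[OF K \<Gamma>])
  let ?gen = "lie_pres_gen K ?X R"
  interpret G: lie_algebra K G
    unfolding G_eq by (rule lie_algebra_lie_pres[OF K R])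
  have gen: "?gen v \<in> carrier G" if "v \<in> ?X" for v
    unfolding G_eq by (rule lie_pres_gen_carrier[OF K R that])
  define w where "w v = (\<lambda>i. if i = CX then \<alpha> (?gen v) else if i = CA0 then \<beta> (?gen v) else \<zero>\<^bsub>K\<^esub>)" for v
  have w: "w v \<in> carrier ?H" if "v \<in> ?X" for v
    using closed gen[OF that] by (simp add: w_def)
  \<comment> \<open>When only \<open>CX\<close> and \<open>CA0\<close> are nonzero, the sole
    coordinate of a bracket that can survive is \<open>CA1\<close>, and it equals the minor of
    \<alpha> and \<beta>.\<close>
  have edge: "test_bracket K (w p) (w q) = \<zero>\<^bsub>?H\<^esub>" if pq: "p \<rightarrow>\<^bsub>\<Gamma>\<^esub> q" for p q
  proof
    have X: "p \<in> ?X" "q \<in> ?X"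
      using pq by (auto dest: adj_in_verts)
    have "?gen p \<otimes>\<^bsub>G\<^esub> ?gen q = \<zero>\<^bsub>G\<^esub>"
      unfolding G_eq using pq X by (intro lie_pres_gen_bracket[OF K R]) (auto simp: R_def)
    then have "\<alpha> (?gen p) \<otimes>\<^bsub>K\<^esub> \<beta> (?gen q) \<ominus>\<^bsub>K\<^esub> \<alpha> (?gen q) \<otimes>\<^bsub>K\<^esub> \<beta> (?gen p) = \<zero>\<^bsub>K\<^esub>"
      using X by (intro minor gen)
    then show "test_bracket K (w p) (w q) i = \<zero>\<^bsub>?H\<^esub> i" for i
      using closed gen X by (cases i) (simp_all add: w_def K.minus_zero_right)
  qed
  have "\<exists>\<psi> \<in> alg_hom K G ?H. \<forall>v \<in> ?X. \<psi> (?gen v) = w v"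
    unfolding G_eq
  proof (rule lie_pres_lift[OF K R H.lie_algebra_axioms])
    show "w \<in> ?X \<rightarrow> carrier ?H"
      using w by blast
    fix h r
    assume h: "h \<in> alg_hom K ?F ?H" and hX: "\<And>v. v \<in> ?X \<Longrightarrow> h (free_lie_gen K ?X v) = w v" and "r \<in> R"
    then obtain p q where pq: "p \<rightarrow>\<^bsub>\<Gamma>\<^esub> q" and r: "r = free_lie_gen K ?X p \<otimes>\<^bsub>?F\<^esub> free_lie_gen K ?X q"
      by (auto simp: R_def)
    have "p \<in> ?X" "q \<in> ?X"
      using pq by (auto dest: adj_in_verts)
    then have "h r = test_bracket K (w p) (w q)"
      by (simp add: r alg_hom_prod[OF h] free_lie_gen_carrier[OF K] hX)
    then show "h r = \<zero>\<^bsub>?H\<^esub>"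
      using edge[OF pq] by simp
  qed
  then obtain \<psi> where \<psi>: "\<psi> \<in> alg_hom K G ?H" and \<psi>_gen: "\<And>v. v \<in> ?X \<Longrightarrow> \<psi> (?gen v) = w v"
    by blast
  have \<psi>0: "\<psi> \<zero>\<^bsub>G\<^esub> = \<zero>\<^bsub>?H\<^esub>"
    by (rule alg_hom_zero[OF G.vectorspace_axioms H.vectorspace_axioms \<psi>])
  have zero: "\<alpha> \<zero>\<^bsub>G\<^esub> = \<zero>\<^bsub>K\<^esub>" "\<beta> \<zero>\<^bsub>G\<^esub> = \<zero>\<^bsub>K\<^esub>"
    using bracket[of "\<zero>\<^bsub>G\<^esub>" "\<zero>\<^bsub>G\<^esub>"] by simp_all
  \<comment> \<open>Closure under the bracket holds because both sides are zero there: a test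
    bracket has no \<open>CX\<close> or \<open>CA0\<close> coordinate, and \<alpha> and \<beta>
    vanish on brackets.\<close>
  have "subalg K {y \<in> carrier G. \<psi> y CX = \<alpha> y \<and> \<psi> y CA0 = \<beta> y} G"
    unfolding subalg_def
    by (auto intro!: subspaceI G.vectorspace_axioms
        simp: alg_hom_simps(2-)[OF \<psi>] \<psi>0 zero add smult bracket)
  then have "{y \<in> carrier G. \<psi> y CX = \<alpha> y \<and> \<psi> y CA0 = \<beta> y} = carrier G"
    unfolding G_eq
    by (rule lie_pres_subalg_eq[OF K R]) (use gen in \<open>simp add: \<psi>_gen w_def flip: G_eq\<close>)
  then have coord: "\<psi> y CX = \<alpha> y" "\<psi> y CA0 = \<beta> y" if "y \<in> carrier G" for y
    using that by blast+
  have "\<psi> (u \<otimes>\<^bsub>G\<^esub> v \<oplus>\<^bsub>G\<^esub> u' \<otimes>\<^bsub>G\<^esub> v') CA1 = \<zero>\<^bsub>K\<^esub>"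
    by (simp add: sum \<psi>0)
  then show ?thesis
    using mem by (simp add: alg_hom_simps(2-)[OF \<psi>] coord)
qed

section \<open>The test homomorphism and the contradiction\<close>

definition coord_unit :: "('k, 'r) ring_scheme \<Rightarrow> coord \<Rightarrow> coord \<Rightarrow> 'k" where
  "coord_unit K i = (\<lambda>j. if j = i then \<one>\<^bsub>K\<^esub> else \<zero>\<^bsub>K\<^esub>)"

text \<open>Elements of the free product are cosets of cosets and cannot be inspected; this map is
  the source of all statements that something in it is nonzero.\<close>

lemma free_prod_test_hom:
  assumes M: "abelian_lie_algebra K M" and basisM: "vectorspace.basis K M {a, b}" and ab: "a \<noteq> b"
    and N: "abelian_lie_algebra K N" and basisN: "vectorspace.basis K N {x}"
  shows "\<exists>\<eta> \<in> alg_hom K (lie_free_prod K M N) (test_algebra K).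
    \<eta> (free_prod_inl K M N a) = coord_unit K CA0 \<and>
    \<eta> (free_prod_inl K M N b) = coord_unit K CB0 \<and>
    \<eta> (free_prod_inr K M N x) = coord_unit K CX"
proof -
  interpret M: lie_algebra K M
    using M by (simp add: abelian_lie_algebra_def)
  interpret N: lie_algebra K N
    using N by (simp add: abelian_lie_algebra_def)
  interpret H: lie_algebra K "test_algebra K" by (rule M.field.lie_algebra_test)
  have unit [simp]: "coord_unit K i j \<in> carrier K" for i j
    by (simp add: coord_unit_def)
  have self: "test_bracket K (coord_unit K i) (coord_unit K i) = (\<lambda>j. \<zero>\<^bsub>K\<^esub>)" for i
    by (simp add: fun_eq_iff M.field.test_bracket_self)
  have AB: "test_bracket K (coord_unit K CA0) (coord_unit K CB0) j = \<zero>\<^bsub>K\<^esub>"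
    "test_bracket K (coord_unit K CB0) (coord_unit K CA0) j = \<zero>\<^bsub>K\<^esub>" for j
    by (cases j; simp add: coord_unit_def M.R.minus_zero_right)+
  have "\<exists>i \<in> alg_hom K M (test_algebra K). \<forall>u \<in> {a, b}. i u = (if u = a then coord_unit K CA0 else coord_unit K CB0)"
    by (rule abelian_lie_hom_extension[OF M basisM _ H.nonassoc_algebra_axioms]) (auto simp: self AB)
  then obtain i where i: "i \<in> alg_hom K M (test_algebra K)"
    and iab: "i a = coord_unit K CA0" "i b = coord_unit K CB0"
    using ab by auto
  have "\<exists>j \<in> alg_hom K N (test_algebra K). \<forall>v \<in> {x}. j v = coord_unit K CX"
    by (rule abelian_lie_hom_extension[OF N basisN _ H.nonassoc_algebra_axioms]) (auto simp: self)
  then obtain j where j: "j \<in> alg_hom K N (test_algebra K)" and jx: "j x = coord_unit K CX"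
    by auto
  have abx: "a \<in> carrier M" "b \<in> carrier M" "x \<in> carrier N"
    using basisM basisN by (auto simp: M.basis_def N.basis_def)
  obtain h where "h \<in> alg_hom K (lie_free_prod K M N) (test_algebra K)"
    and "\<And>u. u \<in> carrier M \<Longrightarrow> h (free_prod_inl K M N u) = i u"
    and "\<And>v. v \<in> carrier N \<Longrightarrow> h (free_prod_inr K M N v) = j v"
    using lie_free_prod_lift[OF M.lie_algebra_axioms N.lie_algebra_axioms H.lie_algebra_axioms i j]
    by blast
  then show ?thesis
    using abx by (intro bexI[of _ h]) (simp_all add: iab jx)
qed

text \<open>Bracketing with \<open>x\<close> is a derivation, here applied to
  \<open>a \<otimes> b = \<zero>\<close>. The cyclic form of the Jacobi identity produces the
  negative of the sum, hence the sign change at the end.\<close>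

lemma (in lie_algebra) bracket_relation_from_commuting:
  assumes [simp]: "a \<in> carrier L" "b \<in> carrier L" "x \<in> carrier L" and "a \<otimes> b = \<zero>"
  shows "(x \<otimes> a) \<otimes> b \<oplus> a \<otimes> (x \<otimes> b) = \<zero>"
proof -
  have "a \<otimes> (b \<otimes> x) = \<ominus> (a \<otimes> (x \<otimes> b))"
    using prod_minus_right[of a \<zero> "x \<otimes> b"] bracket_anticomm[of b x] by (simp add: a_minus_def)
  moreover have "b \<otimes> (x \<otimes> a) = \<ominus> ((x \<otimes> a) \<otimes> b)"
    by (rule bracket_anticomm) simp_all
  ultimately have "\<ominus> (a \<otimes> (x \<otimes> b)) \<oplus> \<ominus> ((x \<otimes> a) \<otimes> b) = \<zero>"
    using jacobi[of x a b] assms by simp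
  then have "\<ominus> ((x \<otimes> a) \<otimes> b \<oplus> a \<otimes> (x \<otimes> b)) = \<zero>"
    by (simp add: M.minus_add M.a_comm)
  then show ?thesis
    using M.minus_minus[of "(x \<otimes> a) \<otimes> b \<oplus> a \<otimes> (x \<otimes> b)"] M.minus_zero_right[of \<zero>]
    by (simp add: a_minus_def)
qed

lemma free_prod_subalg_not_raa:
  fixes K :: "('k, 'r) ring_scheme"
    and M :: "('k, 'a, 'm) module_scheme" and N :: "('k, 'b, 'n) module_scheme"
    and a b :: 'a and x :: 'b and \<Gamma> :: "('v, 'e) pre_digraph"
  defines "L \<equiv> lie_free_prod K M N"
    and "a' \<equiv> free_prod_inl K M N a"
    and "b' \<equiv> free_prod_inl K M N b"
    and "x' \<equiv> free_prod_inr K M N x"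
  defines "z \<equiv> x' \<otimes>\<^bsub>L\<^esub> a'"
    and "t \<equiv> x' \<otimes>\<^bsub>L\<^esub> b'"
  defines "S \<equiv> L\<lparr>carrier := subalg_gen K L {a', b', z, t}\<rparr>"
  assumes M: "abelian_lie_algebra K M" and basisM: "vectorspace.basis K M {a, b}" and ab: "a \<noteq> b"
    and N: "abelian_lie_algebra K N" and basisN: "vectorspace.basis K N {x}"
    and \<Gamma>: "wf_digraph \<Gamma>"
  shows "\<not> alg_isomorphic K S (raa_lie K \<Gamma>)"
proof
  let ?G = "raa_lie K \<Gamma>" and ?H = "test_algebra K"
  assume "alg_isomorphic K S ?G"
  then obtain f where iso: "f \<in> alg_iso K S ?G"
    by (auto simp: alg_isomorphic_def)
  then have f: "f \<in> alg_hom K S ?G" and bij: "bij_betw f (carrier S) (carrier ?G)"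
    by (simp_all add: alg_iso_iff)
  interpret M: lie_algebra K M
    using M by (simp add: abelian_lie_algebra_def)
  interpret N: lie_algebra K N
    using N by (simp add: abelian_lie_algebra_def)
  interpret L: lie_algebra K L
    unfolding L_def by (rule lie_algebra_free_prod[OF M.lie_algebra_axioms N.lie_algebra_axioms])
  interpret H: lie_algebra K ?H by (rule M.field.lie_algebra_test)
  interpret wf_digraph \<Gamma> by (rule \<Gamma>)
  note inl = free_prod_inl_hom[OF M.lie_algebra_axioms N.lie_algebra_axioms, folded L_def]
    and inr = free_prod_inr_hom[OF M.lie_algebra_axioms N.lie_algebra_axioms, folded L_def]
  have abxM: "a \<in> carrier M" "b \<in> carrier M" "x \<in> carrier N"
    using basisM basisN by (auto simp: M.basis_def N.basis_def)
  then have abxL: "a' \<in> carrier L" "b' \<in> carrier L" "x' \<in> carrier L"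
    by (simp_all add: a'_def b'_def x'_def alg_hom_closed[OF inl] alg_hom_closed[OF inr])
  then have ztL: "z \<in> carrier L" "t \<in> carrier L"
    by (simp_all add: z_def t_def)
  define T where "T = subalg_gen K L {a', b', z, t}"
  have T: "subalg K T L"
    unfolding T_def using abxL ztL by (intro L.subalg_gen_subalg) simp
  have TL: "T \<subseteq> carrier L"
    by (rule subspace_subset[OF subalg_subspace[OF T]])
  have gensT: "a' \<in> T" "b' \<in> T" "z \<in> T" "t \<in> T"
    using subalg_gen_superset[of "{a', b', z, t}" K L] by (auto simp: T_def)
  have S_eq: "S = L\<lparr>carrier := T\<rparr>"
    by (simp add: S_def T_def)
  interpret S: nonassoc_algebra K S
    unfolding S_eq by (rule L.subalg_nonassoc_algebra[OF T])
  have S_simps [simp]: "carrier S = T" "\<zero>\<^bsub>S\<^esub> = \<zero>\<^bsub>L\<^esub>" "u \<oplus>\<^bsub>S\<^esub> v = u \<oplus>\<^bsub>L\<^esub> v"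
    "c \<odot>\<^bsub>S\<^esub> u = c \<odot>\<^bsub>L\<^esub> u" "u \<otimes>\<^bsub>S\<^esub> v = u \<otimes>\<^bsub>L\<^esub> v" for u v c
    by (simp_all add: S_eq)
  obtain \<eta> where \<eta>: "\<eta> \<in> alg_hom K L ?H"
    and \<eta>a: "\<eta> a' = coord_unit K CA0" and \<eta>b: "\<eta> b' = coord_unit K CB0" and \<eta>x: "\<eta> x' = coord_unit K CX"
    using free_prod_test_hom[OF M basisM ab N basisN] unfolding L_def a'_def b'_def x'_def by blast
  have \<eta>z: "\<eta> z = test_bracket K (coord_unit K CX) (coord_unit K CA0)"
    and \<eta>t: "\<eta> t = test_bracket K (coord_unit K CX) (coord_unit K CB0)"
    using abxL by (simp_all add: z_def t_def alg_hom_prod[OF \<eta>] \<eta>a \<eta>b \<eta>x)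
  have \<eta>0: "\<eta> \<zero>\<^bsub>L\<^esub> = \<zero>\<^bsub>?H\<^esub>"
    by (rule alg_hom_zero[OF L.vectorspace_axioms H.vectorspace_axioms \<eta>])
  have \<eta>K [simp]: "\<eta> u i \<in> carrier K" if "u \<in> T" for u i
    using alg_hom_closed[OF \<eta>] TL that by auto
  \<comment> \<open>Without \<open>CX\<close> no bracket inside \<open>T\<close> shifts coordinates,
    so \<open>CA1\<close> and \<open>CB1\<close> vanish on brackets, as \<open>CA0\<close> and
    \<open>CB0\<close> always do. Vanishing of \<open>CA2\<close> and \<open>CB2\<close> reduces
    \<open>CC3\<close> to the minor of \<open>CA1\<close> and \<open>CB1\<close>.\<close>
  have "T \<subseteq> {u \<in> carrier L. \<eta> u CX = \<zero>\<^bsub>K\<^esub> \<and> \<eta> u CA2 = \<zero>\<^bsub>K\<^esub> \<and> \<eta> u CB2 = \<zero>\<^bsub>K\<^esub>}"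
    unfolding T_def
  proof (rule subalg_gen_least)
    show "subalg K {u \<in> carrier L. \<eta> u CX = \<zero>\<^bsub>K\<^esub> \<and> \<eta> u CA2 = \<zero>\<^bsub>K\<^esub> \<and> \<eta> u CB2 = \<zero>\<^bsub>K\<^esub>} L"
      using alg_hom_closed[OF \<eta>] unfolding subalg_def
      by (auto intro!: subspaceI L.vectorspace_axioms
          simp: alg_hom_simps(2-)[OF \<eta>] \<eta>0 M.R.minus_zero_right)
    show "{a', b', z, t} \<subseteq> {u \<in> carrier L. \<eta> u CX = \<zero>\<^bsub>K\<^esub> \<and> \<eta> u CA2 = \<zero>\<^bsub>K\<^esub> \<and> \<eta> u CB2 = \<zero>\<^bsub>K\<^esub>}"
      using abxL ztL
      by (auto simp: \<eta>a \<eta>b \<eta>z \<eta>t coord_unit_def M.R.minus_zero_right)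
  qed
  then have \<eta>T [simp]: "\<eta> u CX = \<zero>\<^bsub>K\<^esub>" "\<eta> u CA2 = \<zero>\<^bsub>K\<^esub>" "\<eta> u CB2 = \<zero>\<^bsub>K\<^esub>" if "u \<in> T" for u
    using that by blast+
  have minor: "\<eta> u CA1 \<otimes>\<^bsub>K\<^esub> \<eta> v CB0 \<ominus>\<^bsub>K\<^esub> \<eta> u CB0 \<otimes>\<^bsub>K\<^esub> \<eta> v CA1 = \<zero>\<^bsub>K\<^esub>"
    if uv: "u \<in> T" "v \<in> T" "u \<otimes>\<^bsub>L\<^esub> v = \<zero>\<^bsub>L\<^esub>" for u v
  proof -
    have "u \<in> carrier L" "v \<in> carrier L"
      using uv TL by blast+
    then have "test_bracket K (\<eta> u) (\<eta> v) i = \<zero>\<^bsub>K\<^esub>" for i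
      using alg_hom_prod[OF \<eta>, of u v] \<eta>0 uv(3) by (simp add: fun_eq_iff)
    \<comment> \<open>These coordinates are the premises \<open>ac\<close>, \<open>ad\<close> and
      \<open>cd\<close> of \<open>pluecker_vanish\<close>, in this order.\<close>
    from this[of CC1] this[of CC2] this[of CC3] show ?thesis
      using uv
      by (intro M.field.pluecker_vanish[of "\<eta> u CA0" "\<eta> u CB0" "\<eta> u CA1" "\<eta> u CB1"
            "\<eta> v CA0" "\<eta> v CB0" "\<eta> v CA1" "\<eta> v CB1"]) (simp_all add: M.R.minus_zero_right)
  qed
  define g where "g = inv_into (carrier S) f"
  have g: "g \<in> alg_hom K ?G S"
    unfolding g_def by (rule alg_iso_inv[OF S.nonassoc_algebra_axioms iso])
  have gT: "g y \<in> T" if "y \<in> carrier ?G" for y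
    using alg_hom_closed[OF g that] by simp
  have gf: "g (f u) = u" if "u \<in> T" for u
    using that bij by (simp add: g_def bij_betw_def)
  interpret G: lie_algebra K ?G
    unfolding raa_lie_def
    by (rule lie_algebra_lie_pres[OF M.field.field_axioms raa_relators_closed[OF M.field.field_axioms \<Gamma>]])
  have comm: "a' \<otimes>\<^bsub>L\<^esub> b' = \<zero>\<^bsub>L\<^esub>"
    using M abxM alg_hom_prod[OF inl, of a b] alg_hom_zero[OF M.vectorspace_axioms L.vectorspace_axioms inl]
    by (simp add: a'_def b'_def abelian_lie_algebra_def)
  have "z \<otimes>\<^bsub>L\<^esub> b' \<oplus>\<^bsub>L\<^esub> a' \<otimes>\<^bsub>L\<^esub> t = \<zero>\<^bsub>L\<^esub>"
    unfolding z_def t_def by (rule L.bracket_relation_from_commuting[OF abxL comm])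
  then have "f (z \<otimes>\<^bsub>S\<^esub> b' \<oplus>\<^bsub>S\<^esub> a' \<otimes>\<^bsub>S\<^esub> t) = f \<zero>\<^bsub>S\<^esub>"
    by simp
  then have sum: "f z \<otimes>\<^bsub>?G\<^esub> f b' \<oplus>\<^bsub>?G\<^esub> f a' \<otimes>\<^bsub>?G\<^esub> f t = \<zero>\<^bsub>?G\<^esub>"
    using gensT subalg_prod[OF T]
    by (simp add: alg_hom_add[OF f, simplified] alg_hom_prod[OF f, simplified]
        alg_hom_zero[OF S.vectorspace_axioms G.vectorspace_axioms f, simplified])
  have fG: "f u \<in> carrier ?G" if "u \<in> T" for u
    using alg_hom_closed[OF f] that by simp
  \<comment> \<open>The coordinates along \<open>z\<close> and \<open>b\<close>, transported to the
    graph algebra by the inverse isomorphism; their minor separates the two terms of the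
    relation.\<close>
  let ?\<alpha> = "\<lambda>y. \<eta> (g y) CA1" and ?\<beta> = "\<lambda>y. \<eta> (g y) CB0"
  have gL: "g y \<in> carrier L" if "y \<in> carrier ?G" for y
    using gT[OF that] TL by blast
  note g_simps = alg_hom_simps(2-)[OF g, simplified] alg_hom_simps(2-)[OF \<eta>]
  have "(?\<alpha> (f z) \<otimes>\<^bsub>K\<^esub> ?\<beta> (f b') \<ominus>\<^bsub>K\<^esub> ?\<alpha> (f b') \<otimes>\<^bsub>K\<^esub> ?\<beta> (f z)) \<oplus>\<^bsub>K\<^esub>
      (?\<alpha> (f a') \<otimes>\<^bsub>K\<^esub> ?\<beta> (f t) \<ominus>\<^bsub>K\<^esub> ?\<alpha> (f t) \<otimes>\<^bsub>K\<^esub> ?\<beta> (f a')) = \<zero>\<^bsub>K\<^esub>"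
  proof (rule raa_lie_minor_sum[OF M.field.field_axioms \<Gamma> _ _ _ _ _ _ _ _ _ _ _ _ _ sum])
    fix u v
    assume uv: "u \<in> carrier ?G" "v \<in> carrier ?G" "u \<otimes>\<^bsub>?G\<^esub> v = \<zero>\<^bsub>?G\<^esub>"
    have "g u \<otimes>\<^bsub>L\<^esub> g v = \<zero>\<^bsub>L\<^esub>"
      using uv alg_hom_prod[OF g, of u v] alg_hom_zero[OF G.vectorspace_axioms S.vectorspace_axioms g] by simp
    then have "\<eta> (g u) CA1 \<otimes>\<^bsub>K\<^esub> \<eta> (g v) CB0 \<ominus>\<^bsub>K\<^esub> \<eta> (g u) CB0 \<otimes>\<^bsub>K\<^esub> \<eta> (g v) CA1 = \<zero>\<^bsub>K\<^esub>"
      using uv gT by (intro minor) auto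
    then show "?\<alpha> u \<otimes>\<^bsub>K\<^esub> ?\<beta> v \<ominus>\<^bsub>K\<^esub> ?\<alpha> v \<otimes>\<^bsub>K\<^esub> ?\<beta> u = \<zero>\<^bsub>K\<^esub>"
      using uv gT by (simp add: M.R.m_comm)
  \<comment> \<open>The functionals vanish on brackets because \<open>g\<close> maps into
    \<open>T\<close>, where \<open>CX\<close> is zero, and because no test bracket has a
    \<open>CB0\<close> coordinate.\<close>
  qed (simp_all add: g_simps gL gT fG gensT M.R.minus_zero_right)
  \<comment> \<open>The minor is 1 on the pair \<open>z\<close>, \<open>b'\<close> and 0 on the pair
    \<open>a'\<close>, \<open>t\<close>, so the sum just shown to be zero equals 1.\<close>
  then show False
    using gensT
    by (simp add: gf \<eta>a \<eta>b \<eta>z \<eta>t coord_unit_def M.R.minus_zero_right)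
qed

theorem lemma6p6:
  fixes K :: "('k, 'r) ring_scheme"
    and M :: "('k, 'a, 'm) module_scheme" and N :: "('k, 'b, 'n) module_scheme"
    and a b :: 'a and x :: 'b
  defines "L \<equiv> lie_free_prod K M N"
    and "a' \<equiv> free_prod_inl K M N a"
    and "b' \<equiv> free_prod_inl K M N b"
    and "x' \<equiv> free_prod_inr K M N x"
  defines "z \<equiv> x' \<otimes>\<^bsub>L\<^esub> a'"
    and "t \<equiv> x' \<otimes>\<^bsub>L\<^esub> b'"
  defines "S \<equiv> L\<lparr>carrier := subalg_gen K L {a', b', z, t}\<rparr>"
  defines "X \<equiv> {Inl a, Inl b, Inr x}"
  defines "R \<equiv> {free_lie_gen K X (Inl a) \<otimes>\<^bsub>free_lie K X\<^esub> free_lie_gen K X (Inl b)}"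
  assumes "field K"
    and "abelian_lie_algebra K M" and "vectorspace.basis K M {a, b}" and "a \<noteq> b"
    and "abelian_lie_algebra K N" and "vectorspace.basis K N {x}"
  shows "(\<exists>\<phi> \<in> alg_iso K L (lie_pres K X R).
            \<phi> a' = lie_pres_gen K X R (Inl a) \<and>
            \<phi> b' = lie_pres_gen K X R (Inl b) \<and>
            \<phi> x' = lie_pres_gen K X R (Inr x)) \<and>
         (\<forall>\<Gamma> :: ('v, 'e) pre_digraph. graph \<Gamma> \<longrightarrow> \<not> alg_isomorphic K S (raa_lie K \<Gamma>))"
proof
  show "\<exists>\<phi> \<in> alg_iso K L (lie_pres K X R).
      \<phi> a' = lie_pres_gen K X R (Inl a) \<and>
      \<phi> b' = lie_pres_gen K X R (Inl b) \<and>
      \<phi> x' = lie_pres_gen K X R (Inr x)"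
    unfolding L_def a'_def b'_def x'_def X_def R_def by (rule free_prod_presentation) fact+
  show "\<forall>\<Gamma> :: ('v, 'e) pre_digraph. graph \<Gamma> \<longrightarrow> \<not> alg_isomorphic K S (raa_lie K \<Gamma>)"
  proof (intro allI impI)
    fix \<Gamma> :: "('v, 'e) pre_digraph"
    assume "graph \<Gamma>"
    then interpret graph \<Gamma> .
    show "\<not> alg_isomorphic K S (raa_lie K \<Gamma>)"
      unfolding S_def z_def t_def L_def a'_def b'_def x'_def
      by (rule free_prod_subalg_not_raa) (fact | rule wf_digraph_axioms)+
  qed
qed

end
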